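(* The following hold. (i) $\Omega_A(\cdot)$ defines a seminorm on $\mathbb{B}_A(\mathcal{H})$. (ii) For all $T\in\mathbb{B}_A(\mathcal{H})$, $$\Omega_A(T)=\sup\left\{\sqrt{|\langle Tx,y\rangle_A|^2+|\langle T^{\sharp_A}x,y\rangle_A|^2}\ :\ x,y\in\mathcal{H},\ \|x\|_A=\|y\|_A=1\right\}.$$ (iii) $\Omega_A(\cdot)$ is $A$-selfadjoint invariant, i.e. $\Omega_A(T)=\Omega_A(T^{\sharp_A})$ for all $T\in\mathbb{B}_A(\mathcal{H})$. (iv) For all $T\in\mathbb{B}_A(\mathcal{H})$, $$\|T\|_A\le\Omega_A(T)\le\gamma_A(T)\le\sqrt2\,\|T\|_A,$$ where $\gamma_A(T)=\min\left\{\sqrt{\|TT^{\sharp_A}+T^{\sharp_A}T\|_A},\ \sqrt{\|T\|_A^2+\omega_A(T^2)}\right\}$. (v) If $T\in\mathbb{B}_A(\mathcal{H})$ is $A$-selfadjoint, then $\Omega_A(T)=\sqrt2\,\|T\|_A$.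
   Context: $\mathcal{H}$ is a complex Hilbert space with inner product $\langle\cdot,\cdot\rangle$, $\mathbb{B}(\mathcal{H})$ is the algebra of bounded linear operators on $\mathcal{H}$, and $A\in\mathbb{B}(\mathcal{H})$ is a non-zero positive operator ($\langle Ax,x\rangle\ge 0$ for all $x$). Put $\langle x,y\rangle_A=\langle Ax,y\rangle$ and $\|x\|_A=\sqrt{\langle Ax,x\rangle}$. $\mathbb{B}_A(\mathcal{H})$ is the set of $T\in\mathbb{B}(\mathcal{H})$ with $\mathcal{R}(T^*A)\subseteq\mathcal{R}(A)$ ($\mathcal{R}$ denotes range); it is a subalgebra of $\mathbb{B}(\mathcal{H})$. For $T\in\mathbb{B}_A(\mathcal{H})$, $T^{\sharp_A}$ is the unique $X\in\mathbb{B}(\mathcal{H})$ with $AX=T^*A$ and $\mathcal{R}(X)\subseteq\overline{\mathcal{R}(A)}$; one has $T^{\sharp_A}\in\mathbb{B}_A(\mathcal{H})$. $T\in\mathbb{B}_A(\mathcal{H})$ is $A$-selfadjoint if $AT=T^*A$. For $T\in\mathbb{B}_A(\mathcal{H})$: $\|T\|_A=\sup_{x\in\overline{\mathcal{R}(A)},\,x\ne0}\frac{\|Tx\|_A}{\|x\|_A}$ (which is finite), $\omega_A(T)=\sup\{|\langle Tx,x\rangle_A|:x\in\mathcal{H},\ \|x\|_A=1\}$, and $$\Omega_A(T)=\sup\{\|\alpha T+\beta T^{\sharp_A}\|_A:\ \alpha,\beta\in\mathbb{C},\ |\alpha|^2+|\beta|^2\le1\}.$$ *)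

theory Defs
  imports "HOL-Analysis.Analysis"
begin

text \<open>
  Complex Hilbert spaces.  The inner product is linear in the first argument and conjugate linear
  in the second.  Completeness comes from \<^class>\<open>banach\<close>; the norm, and hence the metric and the
  topology, is the one induced by the inner product.
\<close>

class complex_hilbert_space = banach +
  fixes scaleC :: "complex \<Rightarrow> 'a \<Rightarrow> 'a" (infixr "*\<^sub>C" 75)
    and cinner :: "'a \<Rightarrow> 'a \<Rightarrow> complex"
  assumes scaleC_add_right: "a *\<^sub>C (x + y) = a *\<^sub>C x + a *\<^sub>C y"
    and scaleC_add_left: "(a + b) *\<^sub>C x = a *\<^sub>C x + b *\<^sub>C x"
    and scaleC_scaleC: "a *\<^sub>C b *\<^sub>C x = (a * b) *\<^sub>C x"
    and scaleC_of_real: "complex_of_real r *\<^sub>C x = r *\<^sub>R x"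
    and cinner_add_left: "cinner (x + y) z = cinner x z + cinner y z"
    and cinner_scaleC_left: "cinner (a *\<^sub>C x) y = a * cinner x y"
    and cinner_commute: "cinner x y = cnj (cinner y x)"
    and cinner_self_nonneg: "cinner x x \<in> \<real>\<^sub>\<ge>\<^sub>0"
    and norm_eq_sqrt_cinner: "norm x = sqrt (Re (cinner x x))"

instantiation complex :: complex_hilbert_space
begin

definition scaleC_complex :: "complex \<Rightarrow> complex \<Rightarrow> complex"
  where "scaleC_complex a x = a * x"

definition cinner_complex :: "complex \<Rightarrow> complex \<Rightarrow> complex"
  where "cinner_complex x y = x * cnj y"

instance
  by standard
    (auto simp: scaleC_complex_def cinner_complex_def algebra_simps scaleR_conv_of_real
      complex_nonneg_Reals_iff cmod_def power2_eq_square)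

end

definition bounded_clinear :: "('a::complex_hilbert_space \<Rightarrow> 'a) \<Rightarrow> bool"
  where "bounded_clinear T \<longleftrightarrow> bounded_linear T \<and> (\<forall>c x. T (c *\<^sub>C x) = c *\<^sub>C T x)"

definition positive_op :: "('a::complex_hilbert_space \<Rightarrow> 'a) \<Rightarrow> bool"
  where "positive_op A \<longleftrightarrow> bounded_clinear A \<and> (\<forall>x. cinner (A x) x \<in> \<real>\<^sub>\<ge>\<^sub>0)"

definition cadjoint :: "('a::complex_hilbert_space \<Rightarrow> 'a) \<Rightarrow> 'a \<Rightarrow> 'a"
  where "cadjoint T =
    (THE S. bounded_clinear S \<and> (\<forall>x y. cinner (T x) y = cinner x (S y)))"

definition inner_A :: "('a::complex_hilbert_space \<Rightarrow> 'a) \<Rightarrow> 'a \<Rightarrow> 'a \<Rightarrow> complex"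
  where "inner_A A x y = cinner (A x) y"

definition vnorm_A :: "('a::complex_hilbert_space \<Rightarrow> 'a) \<Rightarrow> 'a \<Rightarrow> real"
  where "vnorm_A A x = sqrt (Re (inner_A A x x))"

definition B_A :: "('a::complex_hilbert_space \<Rightarrow> 'a) \<Rightarrow> ('a \<Rightarrow> 'a) set"
  where "B_A A = {T. bounded_clinear T \<and> range (cadjoint T \<circ> A) \<subseteq> range A}"

definition sharp_A :: "('a::complex_hilbert_space \<Rightarrow> 'a) \<Rightarrow> ('a \<Rightarrow> 'a) \<Rightarrow> 'a \<Rightarrow> 'a"
  where "sharp_A A T =
    (THE X. bounded_clinear X \<and> A \<circ> X = cadjoint T \<circ> A \<and> range X \<subseteq> closure (range A))"

definition selfadjoint_A :: "('a::complex_hilbert_space \<Rightarrow> 'a) \<Rightarrow> ('a \<Rightarrow> 'a) \<Rightarrow> bool"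
  where "selfadjoint_A A T \<longleftrightarrow> A \<circ> T = cadjoint T \<circ> A"

text \<open>
  The suprema below are taken in \<^typ>\<open>real\<close>.  For operators in \<^const>\<open>B_A\<close>, and \<^term>\<open>A\<close> positive
  and nonzero, they are suprema of nonempty bounded sets.
\<close>

definition opnorm_A :: "('a::complex_hilbert_space \<Rightarrow> 'a) \<Rightarrow> ('a \<Rightarrow> 'a) \<Rightarrow> real"
  where "opnorm_A A T =
    Sup {vnorm_A A (T x) / vnorm_A A x | x. x \<in> closure (range A) \<and> x \<noteq> 0}"

definition omega_A :: "('a::complex_hilbert_space \<Rightarrow> 'a) \<Rightarrow> ('a \<Rightarrow> 'a) \<Rightarrow> real"
  where "omega_A A T = Sup {cmod (inner_A A (T x) x) | x. vnorm_A A x = 1}"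

definition Omega_A_set :: "('a::complex_hilbert_space \<Rightarrow> 'a) \<Rightarrow> ('a \<Rightarrow> 'a) \<Rightarrow> real set"
  where "Omega_A_set A T =
    {opnorm_A A (\<lambda>x. \<alpha> *\<^sub>C T x + \<beta> *\<^sub>C sharp_A A T x) | \<alpha> \<beta>. (cmod \<alpha>)\<^sup>2 + (cmod \<beta>)\<^sup>2 \<le> 1}"

definition Omega_A :: "('a::complex_hilbert_space \<Rightarrow> 'a) \<Rightarrow> ('a \<Rightarrow> 'a) \<Rightarrow> real"
  where "Omega_A A T = Sup (Omega_A_set A T)"

definition gamma_A :: "('a::complex_hilbert_space \<Rightarrow> 'a) \<Rightarrow> ('a \<Rightarrow> 'a) \<Rightarrow> real"
  where "gamma_A A T =
    min (sqrt (opnorm_A A (\<lambda>x. T (sharp_A A T x) + sharp_A A T (T x))))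
        (sqrt ((opnorm_A A T)\<^sup>2 + omega_A A (T \<circ> T)))"

definition seminorm_on ::
    "('a::complex_hilbert_space \<Rightarrow> 'a) set \<Rightarrow> (('a \<Rightarrow> 'a) \<Rightarrow> real) \<Rightarrow> bool"
  where "seminorm_on V p \<longleftrightarrow>
    (\<forall>T\<in>V. 0 \<le> p T) \<and>
    (\<forall>c. \<forall>T\<in>V. p (\<lambda>x. c *\<^sub>C T x) = cmod c * p T) \<and>
    (\<forall>S\<in>V. \<forall>T\<in>V. p (\<lambda>x. S x + T x) \<le> p S + p T)"

end

theory Submission
  imports Defs
begin

text \<open>
  Everything rests on the double supremum formula. Write \<open>ip x y = inner_A A x y\<close>, \<open>nrm = vnorm_A A\<close>
  and \<open>X = sharp_A A T\<close>. The operator seminorm of \<open>\<alpha> T + \<beta> X\<close> is the supremum over unit vectors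
  \<open>x\<close>, \<open>y\<close> of the moduli of \<open>\<alpha> ip (T x) y + \<beta> ip (X x) y\<close>. The supremum over the unit ball of
  coefficients can be taken first, with \<open>x\<close> and \<open>y\<close> fixed, and by the Cauchy-Schwarz inequality for
  pairs of complex numbers it is the Euclidean length of \<open>(ip (T x) y, ip (X x) y)\<close>. Hence
  \<open>Omega_A A T\<close> is the supremum of these lengths (\<open>Omega_set_le_iff_pair_form\<close>).

  The remaining claims follow from this formula. A Euclidean length is a seminorm in its entries;
  passing from \<open>T\<close> to \<open>X\<close> swaps the two entries; for selfadjoint \<open>T\<close> the entries agree, which
  produces the factor \<open>sqrt 2\<close>. For the upper bounds, either estimate both entries by
  Cauchy-Schwarz and recognise \<open>(nrm (T x))\<^sup>2 + (nrm (X x))\<^sup>2\<close> as a value of the form of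
  \<open>T X + X T\<close>, or use a Boas-Bellman inequality, whose mixed term \<open>ip (T x) (X x)\<close> equals
  \<open>ip (T (T x)) x\<close>.

  The formula presupposes that \<open>X\<close> exists and is bounded and that the operator seminorms are finite.
  The range condition gives \<open>X\<close> pointwise, by projecting onto the closed range of \<open>A\<close>; it is bounded
  by the uniform boundedness principle (\<open>sharp_exists\<close>). Finiteness means that \<open>T\<close> is bounded for
  \<open>nrm\<close>. It comes from iterating the Cauchy-Schwarz inequality for the symmetric operator \<open>X T\<close>
  (\<open>A_adjoint_nrm_bounded\<close>). Orthogonal projections and adjoints both come from one variational
  lemma, \<open>Riesz_on_closed_subspace\<close>.
\<close>

section \<open>Sesquilinear algebra in a complex Hilbert space\<close>

lemma scaleC_one [simp]: "1 *\<^sub>C x = (x::'a::complex_hilbert_space)"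
  using scaleC_of_real[of 1 x] by simp

lemma scaleC_zero_left [simp]: "0 *\<^sub>C x = (0::'a::complex_hilbert_space)"
  using scaleC_of_real[of 0 x] by simp

lemma scaleC_zero_right [simp]: "c *\<^sub>C (0::'a::complex_hilbert_space) = 0"
  using scaleC_add_right[of c 0 0] by simp

lemma scaleC_minus1 [simp]: "(-1) *\<^sub>C x = - (x::'a::complex_hilbert_space)"
  using scaleC_of_real[of "-1" x] by simp

lemma cinner_zero_left [simp]: "cinner 0 (y::'a::complex_hilbert_space) = 0"
  using cinner_add_left[of 0 0 y] by simp

lemma cinner_minus_left [simp]: "cinner (- x) (y::'a::complex_hilbert_space) = - cinner x y"
  using cinner_scaleC_left[of "-1" x y] by simp

lemma cinner_scaleR_left:
  "cinner (r *\<^sub>R x) (y::'a::complex_hilbert_space) = r * cinner x y"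
  using cinner_scaleC_left[of "complex_of_real r" x y] by (simp add: scaleC_of_real)

lemma cinner_add_right:
  "cinner x (y + z::'a::complex_hilbert_space) = cinner x y + cinner x z"
  by (metis cinner_add_left cinner_commute complex_cnj_add)

lemma cinner_scaleC_right:
  "cinner x (c *\<^sub>C y::'a::complex_hilbert_space) = cnj c * cinner x y"
  by (metis cinner_commute cinner_scaleC_left complex_cnj_mult)

lemma cinner_zero_right [simp]: "cinner (x::'a::complex_hilbert_space) 0 = 0"
  using cinner_add_right[of x 0 0] by simp

lemma cinner_minus_right [simp]: "cinner x (- y::'a::complex_hilbert_space) = - cinner x y"
  using cinner_scaleC_right[of x "-1" y] by simp

lemma cinner_diff_right:
  "cinner x (y - z::'a::complex_hilbert_space) = cinner x y - cinner x z"
  using cinner_add_right[of x y "-z"] by simp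

lemma cinner_scaleR_right:
  "cinner x (r *\<^sub>R y::'a::complex_hilbert_space) = r * cinner x y"
  using cinner_scaleC_right[of x "complex_of_real r" y] by (simp add: scaleC_of_real)

lemma Re_cinner_commute: "Re (cinner y (x::'a::complex_hilbert_space)) = Re (cinner x y)"
  by (subst cinner_commute) simp

lemma cinner_self: "cinner x (x::'a::complex_hilbert_space) = complex_of_real ((norm x)\<^sup>2)"
  using cinner_self_nonneg[of x] norm_eq_sqrt_cinner[of x]
  by (auto simp: complex_nonneg_Reals_iff complex_eq_iff)

lemma Re_cinner_self: "Re (cinner x (x::'a::complex_hilbert_space)) = (norm x)\<^sup>2"
  by (simp only: cinner_self Re_complex_of_real)

lemma norm_add_square:
  "(norm (x + y))\<^sup>2 = (norm x)\<^sup>2 + (norm y)\<^sup>2 + 2 * Re (cinner x (y::'a::complex_hilbert_space))"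
  by (simp add: Re_cinner_self[symmetric] cinner_add_left cinner_add_right
      Re_cinner_commute[of y x])

lemma cinner_ext:
  assumes "\<And>z. cinner z x = cinner z (y::'a::complex_hilbert_space)"
  shows "x = y"
proof -
  have "cinner (x - y) (x - y) = 0"
    by (subst cinner_diff_right) (simp add: assms)
  then show ?thesis
    by (simp add: cinner_self)
qed

lemma bounded_clinear_add: "bounded_clinear T \<Longrightarrow> T (x + y) = T x + T y"
  by (simp add: bounded_clinear_def linear_simps)

lemma bounded_clinear_diff: "bounded_clinear T \<Longrightarrow> T (x - y) = T x - T y"
  by (simp add: bounded_clinear_def linear_simps)

lemma bounded_clinear_zero: "bounded_clinear T \<Longrightarrow> T 0 = 0"
  by (simp add: bounded_clinear_def linear_simps)

lemma bounded_clinear_scaleC: "bounded_clinear T \<Longrightarrow> T (c *\<^sub>C x) = c *\<^sub>C T x"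
  by (simp add: bounded_clinear_def)

lemma bounded_clinearI:
  assumes "\<And>x y. T (x + y) = T x + T y" "\<And>c x. T (c *\<^sub>C x) = c *\<^sub>C T x"
    and "\<And>x. norm (T x) \<le> K * norm x"
  shows "bounded_clinear T"
proof -
  have "bounded_linear T"
  proof (rule bounded_linear_intro)
    show "T (r *\<^sub>R x) = r *\<^sub>R T x" for r x
      by (metis assms(2) scaleC_of_real)
    show "norm (T x) \<le> norm x * K" for x
      using assms(3)[of x] by (simp add: mult.commute)
  qed (rule assms(1))
  then show ?thesis
    unfolding bounded_clinear_def using assms(2) by blast
qed

lemma bounded_clinear_bound:
  assumes "bounded_clinear T"
  obtains K where "K > 0" "\<And>x. norm (T x) \<le> K * norm x"
proof -
  from assms have "bounded_linear T"
    by (simp add: bounded_clinear_def)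
  then obtain K where "K > 0" "\<forall>x. norm (T x) \<le> norm x * K"
    using bounded_linear.pos_bounded by blast
  then show ?thesis
    using that[of K] by (simp add: mult.commute)
qed

lemma bounded_clinear_compose:
  assumes "bounded_clinear S" "bounded_clinear T"
  shows "bounded_clinear (\<lambda>x. S (T x))"
  unfolding bounded_clinear_def
proof
  show "bounded_linear (\<lambda>x. S (T x))"
    using assms by (intro bounded_linear_compose[of S T]) (simp_all add: bounded_clinear_def)
qed (simp add: bounded_clinear_scaleC[OF assms(1)] bounded_clinear_scaleC[OF assms(2)])

lemma bounded_clinear_plus:
  assumes "bounded_clinear S" "bounded_clinear T"
  shows "bounded_clinear (\<lambda>x. S x + T x)"
  unfolding bounded_clinear_def
proof
  show "bounded_linear (\<lambda>x. S x + T x)"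
    using assms by (intro bounded_linear_add[of S T]) (simp_all add: bounded_clinear_def)
qed (simp add: scaleC_add_right bounded_clinear_scaleC[OF assms(1)]
    bounded_clinear_scaleC[OF assms(2)])

lemma bounded_clinear_id: "bounded_clinear (\<lambda>x. x)"
  by (rule bounded_clinearI[where K = 1]) auto

section \<open>The positive semidefinite form of a positive operator\<close>

locale positive_operator =
  fixes A :: "'a::complex_hilbert_space \<Rightarrow> 'a"
  assumes positive: "positive_op A"
begin

abbreviation ip :: "'a \<Rightarrow> 'a \<Rightarrow> complex" where "ip \<equiv> inner_A A"
abbreviation nrm :: "'a \<Rightarrow> real" where "nrm \<equiv> vnorm_A A"

lemma bounded_clinear_A: "bounded_clinear A"
  using positive by (simp add: positive_op_def)

lemma ip_add_left: "ip (x + y) z = ip x z + ip y z"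
  and ip_add_right: "ip x (y + z) = ip x y + ip x z"
  and ip_scaleC_left: "ip (c *\<^sub>C x) y = c * ip x y"
  and ip_scaleC_right: "ip x (c *\<^sub>C y) = cnj c * ip x y"
  by (simp_all add: inner_A_def bounded_clinear_add[OF bounded_clinear_A]
      bounded_clinear_scaleC[OF bounded_clinear_A] cinner_add_left cinner_add_right
      cinner_scaleC_left cinner_scaleC_right)

lemma ip_self: "ip x x = complex_of_real ((nrm x)\<^sup>2)"
proof -
  have "ip x x \<in> \<real>\<^sub>\<ge>\<^sub>0"
    using positive by (simp add: positive_op_def inner_A_def)
  then show ?thesis
    by (auto simp: vnorm_A_def complex_nonneg_Reals_iff complex_eq_iff)
qed

lemma nrm_nonneg [simp]: "0 \<le> nrm x"
proof -
  have "ip x x \<in> \<real>\<^sub>\<ge>\<^sub>0"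
    using positive by (simp add: positive_op_def inner_A_def)
  then show ?thesis
    by (simp add: vnorm_A_def complex_nonneg_Reals_iff)
qed

text \<open>
  Over the complex numbers a form with a real diagonal is Hermitian: the diagonal values at
  \<open>x + y\<close> and at \<open>x + \<i> y\<close> give the imaginary and the real part.
\<close>
lemma ip_commute: "ip y x = cnj (ip x y)"
proof -
  have real: "Im (ip z z) = 0" for z
    by (simp add: ip_self)
  have "Im (ip (x + y) (x + y)) = 0" "Im (ip (x + \<i> *\<^sub>C y) (x + \<i> *\<^sub>C y)) = 0"
    by (rule real)+
  then show ?thesis
    by (simp add: ip_add_left ip_add_right ip_scaleC_left ip_scaleC_right real complex_eq_iff)
qed

lemma A_selfadjoint: "cinner (A x) y = cinner x (A y)"
  using ip_commute unfolding inner_A_def by (metis cinner_commute)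

text \<open>
  The form need not be definite, so the usual minimising multiple of \<open>y\<close> may not exist. All
  vectors \<open>x - r (ip x y) y\<close> with real \<open>r\<close> are therefore considered, and the resulting quadratic
  inequality in \<open>r\<close> is exploited also when its leading coefficient vanishes.
\<close>
lemma ip_Cauchy_Schwarz: "cmod (ip x y) \<le> nrm x * nrm y"
proof -
  define b where "b = (cmod (ip x y))\<^sup>2"
  have quadratic: "0 \<le> (nrm x)\<^sup>2 - 2 * r * b + r\<^sup>2 * b * (nrm y)\<^sup>2" for r
  proof -
    let ?z = "x + (- (complex_of_real r * ip x y)) *\<^sub>C y"
    have b: "ip x y * cnj (ip x y) = complex_of_real b"
      unfolding b_def by (simp only: complex_norm_square)
    have "ip ?z ?z = ip x x - 2 * r * (ip x y * cnj (ip x y))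
        + r\<^sup>2 * (ip x y * cnj (ip x y)) * ip y y"
      by (simp only: ip_add_left ip_add_right ip_scaleC_left ip_scaleC_right ip_commute[of y x])
        (simp add: algebra_simps power2_eq_square)
    then have "complex_of_real ((nrm ?z)\<^sup>2)
        = complex_of_real ((nrm x)\<^sup>2 - 2 * r * b + r\<^sup>2 * b * (nrm y)\<^sup>2)"
      by (simp add: b ip_self)
    then have "(nrm ?z)\<^sup>2 = (nrm x)\<^sup>2 - 2 * r * b + r\<^sup>2 * b * (nrm y)\<^sup>2"
      by (simp only: of_real_eq_iff)
    then show ?thesis
      by (metis zero_le_power2)
  qed
  have "b \<le> (nrm x)\<^sup>2 * (nrm y)\<^sup>2"
  proof (cases "nrm y = 0")
    case True
    have "b = 0"
    proof (rule ccontr)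
      assume "b \<noteq> 0"
      then have "2 * (((nrm x)\<^sup>2 + 1) / (2 * b)) * b = (nrm x)\<^sup>2 + 1"
        by simp
      then show False
        using quadratic[of "((nrm x)\<^sup>2 + 1) / (2 * b)"] True by simp
    qed
    then show ?thesis
      by simp
  next
    case False
    let ?r = "1 / (nrm y)\<^sup>2"
    have "?r\<^sup>2 * b * (nrm y)\<^sup>2 = ?r * b"
      using False by (simp add: power2_eq_square)
    then have "b / (nrm y)\<^sup>2 \<le> (nrm x)\<^sup>2"
      using quadratic[of ?r] by simp
    then show ?thesis
      using False by (simp add: divide_le_eq)
  qed
  then have "(cmod (ip x y))\<^sup>2 \<le> (nrm x * nrm y)\<^sup>2"
    by (simp add: b_def power_mult_distrib)
  then show ?thesis
    by (rule power2_le_imp_le) simp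
qed

lemma nrm_scaleC: "nrm (c *\<^sub>C x) = cmod c * nrm x"
proof -
  have "ip (c *\<^sub>C x) (c *\<^sub>C x) = c * cnj c * ip x x"
    by (simp add: ip_scaleC_left ip_scaleC_right)
  also have "\<dots> = complex_of_real ((cmod c * nrm x)\<^sup>2)"
    by (simp add: ip_self power_mult_distrib flip: complex_norm_square)
  finally have "(nrm (c *\<^sub>C x))\<^sup>2 = (cmod c * nrm x)\<^sup>2"
    by (simp only: ip_self of_real_eq_iff)
  then show ?thesis
    by (simp add: power2_eq_iff_nonneg)
qed

lemma nrm_zero [simp]: "nrm 0 = 0"
  using nrm_scaleC[of 0 0] by simp

lemma ip_eq_0: "nrm x = 0 \<Longrightarrow> ip x y = 0"
  using ip_Cauchy_Schwarz[of x y] by simp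

lemma nrm_eq_0_iff: "nrm x = 0 \<longleftrightarrow> A x = 0"
proof
  assume "nrm x = 0"
  then have "cinner (A x) (A x) = 0"
    using ip_eq_0[of x "A x"] by (simp add: inner_A_def)
  then show "A x = 0"
    by (simp add: cinner_self)
qed (simp add: vnorm_A_def inner_A_def)

end

text \<open>
  The inner product is the form of the identity operator, so it inherits what holds for forms.
\<close>
lemma cinner_Cauchy_Schwarz: "cmod (cinner x y) \<le> norm x * norm (y::'a::complex_hilbert_space)"
  and norm_scaleC: "norm (c *\<^sub>C x) = cmod c * norm (x::'a)"
proof -
  interpret positive_operator "\<lambda>x::'a. x"
    by standard (simp add: positive_op_def bounded_clinear_id cinner_self_nonneg)
  show "cmod (cinner x y) \<le> norm x * norm y"
    using ip_Cauchy_Schwarz[of x y] by (simp add: inner_A_def vnorm_A_def norm_eq_sqrt_cinner)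
  show "norm (c *\<^sub>C x) = cmod c * norm x"
    using nrm_scaleC[of c x] by (simp add: inner_A_def vnorm_A_def norm_eq_sqrt_cinner)
qed

lemma bounded_clinear_scaled:
  assumes "bounded_clinear T"
  shows "bounded_clinear (\<lambda>x. c *\<^sub>C T x)"
proof -
  obtain K where K: "\<And>x. norm (T x) \<le> K * norm x"
    using bounded_clinear_bound[OF assms] by blast
  show ?thesis
  proof (rule bounded_clinearI)
    show "norm (c *\<^sub>C T x) \<le> (cmod c * K) * norm x" for x
      using mult_left_mono[OF K[of x] norm_ge_zero[of c]] by (simp add: norm_scaleC mult.assoc)
  qed (simp_all add: bounded_clinear_add[OF assms] bounded_clinear_scaleC[OF assms]
      scaleC_add_right scaleC_scaleC mult.commute)
qed

lemma (in positive_operator) nrm_le_norm: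
  obtains K where "K > 0" "\<And>x. nrm x \<le> K * norm x"
proof -
  obtain C where C: "C > 0" "\<And>x. norm (A x) \<le> C * norm x"
    using bounded_clinear_bound[OF bounded_clinear_A] by blast
  have "nrm x \<le> sqrt C * norm x" for x
  proof (rule power2_le_imp_le)
    have "(nrm x)\<^sup>2 = cmod (ip x x)"
      by (simp add: ip_self norm_power)
    also have "\<dots> \<le> norm (A x) * norm x"
      unfolding inner_A_def by (rule cinner_Cauchy_Schwarz)
    also have "\<dots> \<le> (C * norm x) * norm x"
      using C(2) by (rule mult_right_mono) simp
    finally show "(nrm x)\<^sup>2 \<le> (sqrt C * norm x)\<^sup>2"
      using C(1) by (simp add: power_mult_distrib) (simp add: power2_eq_square mult_ac)
  qed (use C(1) in simp)
  then show ?thesis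
    using that[of "sqrt C"] C(1) by simp
qed

section \<open>Orthogonality, adjoints and uniform boundedness\<close>

lemma bounded_linear_cinner_left:
  "bounded_linear (\<lambda>x. cinner x (y::'a::complex_hilbert_space))"
  by (rule bounded_linear_intro[where K = "norm y"])
    (simp_all add: cinner_add_left cinner_scaleR_left scaleR_conv_of_real cinner_Cauchy_Schwarz)

definition csubspace :: "'a::complex_hilbert_space set \<Rightarrow> bool"
  where "csubspace M \<longleftrightarrow>
    0 \<in> M \<and> (\<forall>x\<in>M. \<forall>y\<in>M. x + y \<in> M) \<and> (\<forall>c. \<forall>x\<in>M. c *\<^sub>C x \<in> M)"

lemma csubspace_add: "csubspace M \<Longrightarrow> x \<in> M \<Longrightarrow> y \<in> M \<Longrightarrow> x + y \<in> M"
  and csubspace_scaleC: "csubspace M \<Longrightarrow> x \<in> M \<Longrightarrow> c *\<^sub>C x \<in> M"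
  and csubspace_zero: "csubspace M \<Longrightarrow> 0 \<in> M"
  by (simp_all add: csubspace_def)

lemma csubspace_scaleR: "csubspace M \<Longrightarrow> x \<in> M \<Longrightarrow> r *\<^sub>R x \<in> M"
  using csubspace_scaleC[of M x "complex_of_real r"] by (simp add: scaleC_of_real)

lemma csubspace_diff: "csubspace M \<Longrightarrow> x \<in> M \<Longrightarrow> y \<in> M \<Longrightarrow> x - y \<in> M"
  using csubspace_add[of M x "-y"] csubspace_scaleC[of M y "-1"] by simp

lemma csubspace_UNIV: "csubspace UNIV"
  by (simp add: csubspace_def)

lemma csubspace_range:
  assumes "bounded_clinear T"
  shows "csubspace (range T)"
  unfolding csubspace_def
proof (intro conjI ballI allI)
  show "0 \<in> range T"
    by (metis assms bounded_clinear_zero rangeI)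
  show "x + y \<in> range T" if "x \<in> range T" "y \<in> range T" for x y
    using that by (auto simp: bounded_clinear_add[OF assms, symmetric])
  show "c *\<^sub>C x \<in> range T" if "x \<in> range T" for c x
    using that by (auto simp: bounded_clinear_scaleC[OF assms, symmetric])
qed

lemma csubspace_closure:
  assumes "csubspace M"
  shows "csubspace (closure M)"
  unfolding csubspace_def
proof (intro conjI ballI allI)
  show "0 \<in> closure M"
    using assms closure_subset by (auto simp: csubspace_def)
next
  fix x y
  assume "x \<in> closure M" "y \<in> closure M"
  then obtain u v where "\<forall>n. u n \<in> M" "u \<longlonglongrightarrow> x" "\<forall>n. v n \<in> M" "v \<longlonglongrightarrow> y"
    unfolding closure_sequential by blast
  then have "\<forall>n. u n + v n \<in> M" "(\<lambda>n. u n + v n) \<longlonglongrightarrow> x + y"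
    using assms by (auto intro: csubspace_add tendsto_add)
  then show "x + y \<in> closure M"
    unfolding closure_sequential by (intro exI[of _ "\<lambda>n. u n + v n"] conjI)
next
  fix c x
  assume "x \<in> closure M"
  then obtain u where "\<forall>n. u n \<in> M" "u \<longlonglongrightarrow> x"
    unfolding closure_sequential by blast
  moreover have "bounded_linear (\<lambda>x::'a. c *\<^sub>C x)"
    using bounded_clinear_scaled[OF bounded_clinear_id, of c] unfolding bounded_clinear_def ..
  ultimately have "\<forall>n. c *\<^sub>C u n \<in> M" "(\<lambda>n. c *\<^sub>C u n) \<longlonglongrightarrow> c *\<^sub>C x"
    using assms by (auto intro: csubspace_scaleC bounded_linear.tendsto)
  then show "c *\<^sub>C x \<in> closure M"
    unfolding closure_sequential by (intro exI[of _ "\<lambda>n. c *\<^sub>C u n"] conjI)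
qed

text \<open>
  The representing vector minimises \<open>q y = \<parallel>y\<parallel>\<^sup>2 - 2 Re (f y)\<close> over \<open>M\<close>. The functional \<open>q\<close> is
  bounded below because \<open>f\<close> is bounded, the parallelogram identity makes minimising sequences
  Cauchy, and the vanishing of the first variation of \<open>q\<close> at the minimum is the asserted identity.
  For \<open>M = UNIV\<close> this is the Riesz representation theorem; for \<open>f y = cinner y x\<close> the vector
  found is the orthogonal projection of \<open>x\<close> onto \<open>M\<close>.
\<close>
lemma Riesz_on_closed_subspace:
  fixes f :: "'a::complex_hilbert_space \<Rightarrow> complex"
  assumes M: "csubspace M" "closed M"
    and f: "bounded_linear f" "\<And>c x. f (c *\<^sub>C x) = c * f x"
  obtains z where "z \<in> M" "\<And>y. y \<in> M \<Longrightarrow> f y = cinner y z"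
proof -
  interpret f: bounded_linear f
    by (rule f(1))
  obtain K where K: "\<And>x. cmod (f x) \<le> norm x * K"
    using f.bounded by blast
  define q where "q y = (norm y)\<^sup>2 - 2 * Re (f y)" for y
  define m where "m = Inf (q ` M)"
  have "- K\<^sup>2 \<le> q y" for y
  proof -
    have "Re (f y) \<le> norm y * K"
      using K[of y] complex_Re_le_cmod[of "f y"] by linarith
    moreover have "0 \<le> (norm y - K)\<^sup>2"
      by simp
    ultimately show ?thesis
      by (simp add: q_def power2_diff)
  qed
  then have bdd: "bdd_below (q ` M)"
    by (intro bdd_belowI[of _ "- K\<^sup>2"]) auto
  have m_le: "m \<le> q y" if "y \<in> M" for y
    unfolding m_def using bdd that by (intro cInf_lower) auto
  have parallelogram: "(norm (u - v))\<^sup>2 \<le> 2 * (q u - m) + 2 * (q v - m)" if "u \<in> M" "v \<in> M" for u v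
  proof -
    have "(1/2) *\<^sub>R (u + v) \<in> M"
      using that M by (intro csubspace_scaleR csubspace_add)
    then have "m \<le> q ((1/2) *\<^sub>R (u + v))"
      by (rule m_le)
    also have "q ((1/2) *\<^sub>R (u + v)) = (norm (u + v))\<^sup>2 / 4 - Re (f u + f v)"
      unfolding q_def f.scaleR f.add norm_scaleR by (simp add: power2_eq_square add_divide_distrib)
    finally have "4 * m \<le> (norm (u + v))\<^sup>2 - 4 * Re (f u + f v)"
      by simp
    moreover have "(norm (u + v))\<^sup>2 + (norm (u - v))\<^sup>2 = 2 * (norm u)\<^sup>2 + 2 * (norm v)\<^sup>2"
      using norm_add_square[of u v] norm_add_square[of u "- v"] by simp
    ultimately show ?thesis
      by (simp add: q_def)
  qed
  have "\<exists>y\<in>M. q y < m + inverse (real (Suc n))" for n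
  proof -
    have "q ` M \<noteq> {}"
      using csubspace_zero[OF M(1)] by blast
    then show ?thesis
      using bdd cInf_less_iff[of "q ` M" "m + inverse (real (Suc n))"] by (auto simp: m_def)
  qed
  then obtain u where u: "\<And>n. u n \<in> M" "\<And>n. q (u n) < m + inverse (real (Suc n))"
    by metis
  have "Cauchy u"
  proof (rule metric_CauchyI)
    fix e :: real
    assume "e > 0"
    then obtain N where N: "inverse (real (Suc N)) < e\<^sup>2 / 4"
      using reals_Archimedean[of "e\<^sup>2 / 4"] by auto
    have close: "q (u i) - m < e\<^sup>2 / 4" if "i \<ge> N" for i
    proof -
      have "inverse (real (Suc i)) \<le> inverse (real (Suc N))"
        using that by (intro le_imp_inverse_le) auto
      then show ?thesis
        using u(2)[of i] N by linarith
    qed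
    have "dist (u i) (u j) < e" if "i \<ge> N" "j \<ge> N" for i j
    proof (rule power2_less_imp_less)
      show "(dist (u i) (u j))\<^sup>2 < e\<^sup>2"
        using parallelogram[OF u(1) u(1), of i j] close[OF that(1)] close[OF that(2)]
        by (simp add: dist_norm)
    qed (use \<open>e > 0\<close> in simp)
    then show "\<exists>N. \<forall>i\<ge>N. \<forall>j\<ge>N. dist (u i) (u j) < e"
      by blast
  qed
  then obtain z where z: "u \<longlonglongrightarrow> z"
    using Cauchy_convergent_iff convergent_def by blast
  have "z \<in> M"
    using M(2) z u(1) closed_sequentially by blast
  have "(\<lambda>n. q (u n)) \<longlonglongrightarrow> q z"
    unfolding q_def by (intro tendsto_intros z f.tendsto)
  moreover have "(\<lambda>n. m + inverse (real (Suc n))) \<longlonglongrightarrow> m + 0"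
    by (intro tendsto_add tendsto_const LIMSEQ_inverse_real_of_nat)
  ultimately have q_z: "q z \<le> m"
    using u(2) by (intro LIMSEQ_le[of _ _ "\<lambda>n. m + inverse (real (Suc n))" m])
      (auto intro: less_imp_le)
  have Re_eq: "Re (f y) = Re (cinner y z)" if "y \<in> M" for y
  proof (rule ccontr)
    define d where "d = Re (cinner y z) - Re (f y)"
    assume "Re (f y) \<noteq> Re (cinner y z)"
    then have "d \<noteq> 0" "y \<noteq> 0"
      by (auto simp: d_def f.zero)
    \<comment> \<open>the minimum of \<open>q\<close> on the line through \<open>z\<close> in direction \<open>y\<close>\<close>
    define t where "t = - d / (norm y)\<^sup>2"
    have "z + t *\<^sub>R y \<in> M"
      using \<open>z \<in> M\<close> that M by (intro csubspace_add csubspace_scaleR)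
    then have "q z \<le> q (z + t *\<^sub>R y)"
      using m_le q_z by fastforce
    then have "0 \<le> t\<^sup>2 * (norm y)\<^sup>2 + 2 * t * d"
      by (simp add: q_def norm_add_square f.add f.scaleR cinner_scaleR_right d_def
          Re_cinner_commute[of z y] power_mult_distrib algebra_simps)
    also have "\<dots> = - (d\<^sup>2 / (norm y)\<^sup>2)"
      using \<open>y \<noteq> 0\<close> by (simp add: t_def power2_eq_square field_simps)
    finally show False
      using \<open>d \<noteq> 0\<close> \<open>y \<noteq> 0\<close> by (simp add: divide_le_0_iff)
  qed
  have "f y = cinner y z" if "y \<in> M" for y
  proof (rule complex_eqI)
    show "Re (f y) = Re (cinner y z)"
      using that by (rule Re_eq)
    have "\<i> *\<^sub>C y \<in> M"
      using M(1) that by (rule csubspace_scaleC)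
    then show "Im (f y) = Im (cinner y z)"
      using Re_eq[of "\<i> *\<^sub>C y"] by (simp add: f(2) cinner_scaleC_left)
  qed
  with \<open>z \<in> M\<close> show ?thesis
    by (rule that)
qed

lemma orthogonal_projection:
  fixes x :: "'a::complex_hilbert_space"
  assumes "csubspace M" "closed M"
  obtains p where "p \<in> M" "\<And>y. y \<in> M \<Longrightarrow> cinner y (x - p) = 0"
proof -
  obtain p where "p \<in> M" "\<And>y. y \<in> M \<Longrightarrow> cinner y x = cinner y p"
    using Riesz_on_closed_subspace[OF assms bounded_linear_cinner_left[of x]]
    by (metis cinner_scaleC_left)
  then show ?thesis
    using that by (simp add: cinner_diff_right)
qed

lemma adjoint_bounded_clinear:
  fixes S :: "'a::complex_hilbert_space \<Rightarrow> 'a"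
  assumes T: "bounded_clinear T" and adj: "\<And>x y. cinner (T x) y = cinner x (S y)"
  shows "bounded_clinear S"
proof -
  obtain K where K: "K > 0" "\<And>x. norm (T x) \<le> K * norm x"
    using bounded_clinear_bound[OF T] by blast
  show ?thesis
  proof (rule bounded_clinearI)
    show "S (x + y) = S x + S y" for x y
      by (rule cinner_ext) (simp add: cinner_add_right flip: adj)
    show "S (c *\<^sub>C x) = c *\<^sub>C S x" for c x
      by (rule cinner_ext) (simp add: cinner_scaleC_right flip: adj)
    show "norm (S x) \<le> K * norm x" for x
    proof (cases "S x = 0")
      case False
      have "norm (S x) * norm (S x) = cmod (cinner (T (S x)) x)"
        by (simp add: adj cinner_self norm_power power2_eq_square norm_mult)
      also have "\<dots> \<le> norm (T (S x)) * norm x"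
        by (rule cinner_Cauchy_Schwarz)
      also have "\<dots> \<le> (K * norm (S x)) * norm x"
        using K(2) by (rule mult_right_mono) simp
      finally show ?thesis
        using False by (simp add: mult_ac)
    qed (use K(1) in simp)
  qed
qed

lemma cadjoint:
  fixes T :: "'a::complex_hilbert_space \<Rightarrow> 'a"
  assumes T: "bounded_clinear T"
  shows bounded_clinear_cadjoint: "bounded_clinear (cadjoint T)"
    and cinner_cadjoint: "cinner (T x) y = cinner x (cadjoint T y)"
proof -
  have "\<exists>z. \<forall>x. cinner (T x) y = cinner x z" for y
  proof -
    have "bounded_linear (\<lambda>x. cinner (T x) y)"
      using T by (intro bounded_linear_compose[OF bounded_linear_cinner_left])
        (simp add: bounded_clinear_def)
    moreover have "cinner (T (c *\<^sub>C x)) y = c * cinner (T x) y" for c x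
      by (simp add: bounded_clinear_scaleC[OF T] cinner_scaleC_left)
    ultimately obtain z where "\<And>x. x \<in> UNIV \<Longrightarrow> cinner (T x) y = cinner x z"
      using Riesz_on_closed_subspace[OF csubspace_UNIV closed_UNIV] by blast
    then show ?thesis
      by blast
  qed
  then obtain S where S: "\<And>x y. cinner (T x) y = cinner x (S y)"
    by metis
  have "\<exists>!S. bounded_clinear S \<and> (\<forall>x y. cinner (T x) y = cinner x (S y))"
  proof (rule ex1I[of _ S])
    show "bounded_clinear S \<and> (\<forall>x y. cinner (T x) y = cinner x (S y))"
    proof (intro conjI allI)
      show "bounded_clinear S"
        using T S by (rule adjoint_bounded_clinear)
    qed (rule S)
    show "S' = S" if "bounded_clinear S' \<and> (\<forall>x y. cinner (T x) y = cinner x (S' y))" for S'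
    proof
      show "S' y = S y" for y
      proof (rule cinner_ext)
        show "cinner z (S' y) = cinner z (S y)" for z
          using that S[of z y] by metis
      qed
    qed
  qed
  from theI'[OF this, folded cadjoint_def]
  have *: "bounded_clinear (cadjoint T) \<and> (\<forall>x y. cinner (T x) y = cinner x (cadjoint T y))" .
  show "bounded_clinear (cadjoint T)"
    using * ..
  show "cinner (T x) y = cinner x (cadjoint T y)"
    using * by blast
qed

text \<open>
  The closed sets on which all \<open>f i\<close> are bounded by \<open>n\<close> cover the space, so one of them contains a
  ball by the Baire category theorem; differences of points of the ball give the bound near the
  origin.
\<close>
lemma uniform_boundedness:
  fixes f :: "'i \<Rightarrow> 'a::banach \<Rightarrow> 'b::real_normed_vector"
  assumes lin: "\<And>i. bounded_linear (f i)" and bdd: "\<And>x. \<exists>C. \<forall>i. norm (f i x) \<le> C"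
  obtains K where "\<And>i x. norm (f i x) \<le> K * norm x"
proof -
  define F where "F n = {x. \<forall>i. norm (f i x) \<le> real n}" for n
  have "x \<in> \<Union>(range F)" for x
  proof -
    obtain C where C: "\<forall>i. norm (f i x) \<le> C"
      using bdd by blast
    obtain n :: nat where "C \<le> real n"
      using real_arch_simple by blast
    then have "x \<in> F n"
      using C by (auto simp: F_def intro: order_trans)
    then show ?thesis
      by blast
  qed
  then have cover: "\<Union>(range F) = UNIV"
    by blast
  have closed: "closed (F n)" for n
  proof -
    have "closed {x. norm (f i x) \<le> real n}" for i
      using lin by (intro closed_Collect_le continuous_intros linear_continuous_on)
    then show ?thesis
      unfolding F_def by (rule closed_Collect_all)
  qed
  have "\<exists>n. interior (F n) \<noteq> {}"
  proof (rule ccontr)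
    assume "\<not> ?thesis"
    then have "Met_TC.mtopology interior_of \<Union>(range F) = {}"
      using closed by (intro Met_TC.metric_Baire_category_alt)
        (auto simp: complete_UNIV interior_of_def interior_def)
    then show False
      by (simp add: cover)
  qed
  then obtain n a where "a \<in> interior (F n)"
    by blast
  then obtain r where r: "r > 0" "ball a r \<subseteq> F n"
    by (meson mem_interior)
  have "norm (f i x) \<le> (4 * real n / r) * norm x" for i x
  proof (cases "x = 0")
    case False
    interpret fi: bounded_linear "f i"
      by (rule lin)
    define t where "t = r / (2 * norm x)"
    have "t > 0" and t: "t * norm x < r"
      using r False by (simp_all add: t_def)
    have "a \<in> ball a r" "a + t *\<^sub>R x \<in> ball a r"
      using r t \<open>t > 0\<close> by (simp_all add: dist_norm)
    then have "a \<in> F n" "a + t *\<^sub>R x \<in> F n"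
      using r(2) by blast+
    then have "norm (f i a) \<le> n" "norm (f i (a + t *\<^sub>R x)) \<le> n"
      by (simp_all add: F_def)
    moreover have "t *\<^sub>R f i x = f i (a + t *\<^sub>R x) - f i a"
      by (simp add: fi.add fi.scaleR)
    then have "t * norm (f i x) = norm (f i (a + t *\<^sub>R x) - f i a)"
      using \<open>t > 0\<close> by (metis abs_of_pos norm_scaleR)
    ultimately have "t * norm (f i x) \<le> 2 * n"
      using norm_triangle_ineq4[of "f i (a + t *\<^sub>R x)" "f i a"] by linarith
    then show ?thesis
      using r False by (simp add: t_def field_simps)
  qed (simp add: linear_simps lin)
  then show ?thesis
    by (rule that)
qed

context positive_operator
begin

section \<open>Bounded adjoints for the semi-inner product\<close>

text \<open>
  An operator may have many adjoints for the form, since \<open>ip\<close> does not see components in the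
  kernel of \<open>A\<close>. A relation between operators leaves that choice open, and it is stable under
  sums, scalar multiples and composition.
\<close>
definition A_adjoint :: "('a \<Rightarrow> 'a) \<Rightarrow> ('a \<Rightarrow> 'a) \<Rightarrow> bool"
  where "A_adjoint T X \<longleftrightarrow> bounded_clinear T \<and> bounded_clinear X \<and> (\<forall>x y. ip (T x) y = ip x (X y))"

lemma A_adjoint_ip: "A_adjoint T X \<Longrightarrow> ip (T x) y = ip x (X y)"
  and A_adjoint_bounded_left: "A_adjoint T X \<Longrightarrow> bounded_clinear T"
  and A_adjoint_bounded_right: "A_adjoint T X \<Longrightarrow> bounded_clinear X"
  by (simp_all add: A_adjoint_def)

lemma A_adjoint_sym:
  assumes "A_adjoint T X"
  shows "A_adjoint X T"
proof -
  have "ip (X x) y = ip x (T y)" for x y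
  proof -
    have "ip (X x) y = cnj (ip y (X x))"
      by (rule ip_commute)
    also have "\<dots> = cnj (ip (T y) x)"
      by (simp only: A_adjoint_ip[OF assms])
    also have "\<dots> = ip x (T y)"
      by (rule ip_commute[symmetric])
    finally show ?thesis .
  qed
  then show ?thesis
    using assms by (simp add: A_adjoint_def)
qed

lemma A_adjoint_compose:
  assumes "A_adjoint S Y" "A_adjoint T X"
  shows "A_adjoint (\<lambda>x. S (T x)) (\<lambda>x. X (Y x))"
  unfolding A_adjoint_def
  using assms[THEN A_adjoint_bounded_left] assms[THEN A_adjoint_bounded_right]
  by (intro conjI bounded_clinear_compose[of S T] bounded_clinear_compose[of X Y])
    (simp_all add: A_adjoint_ip[OF assms(1)] A_adjoint_ip[OF assms(2)])

lemma A_adjoint_plus: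
  assumes "A_adjoint S Y" "A_adjoint T X"
  shows "A_adjoint (\<lambda>x. S x + T x) (\<lambda>x. Y x + X x)"
  using assms by (simp add: A_adjoint_def bounded_clinear_plus ip_add_left ip_add_right)

lemma A_adjoint_scaled:
  assumes "A_adjoint T X"
  shows "A_adjoint (\<lambda>x. c *\<^sub>C T x) (\<lambda>x. cnj c *\<^sub>C X x)"
  using assms by (simp add: A_adjoint_def bounded_clinear_scaled ip_scaleC_left ip_scaleC_right)

lemma A_adjoint_iff_commutes:
  assumes "bounded_clinear T"
  shows "(\<forall>x y. ip (T x) y = ip x (X y)) \<longleftrightarrow> A \<circ> X = cadjoint T \<circ> A"
proof -
  have left: "ip (T x) y = cinner x (cadjoint T (A y))" for x y
    by (simp add: inner_A_def A_selfadjoint cinner_cadjoint[OF assms])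
  have right: "ip x (X y) = cinner x (A (X y))" for x y
    by (simp add: inner_A_def A_selfadjoint)
  show ?thesis
    unfolding left right fun_eq_iff comp_apply
  proof
    assume eq: "\<forall>x y. cinner x (cadjoint T (A y)) = cinner x (A (X y))"
    show "\<forall>y. A (X y) = cadjoint T (A y)"
      by (rule allI, rule cinner_ext) (simp add: eq)
  qed simp
qed

text \<open>
  Since \<open>A\<close> is selfadjoint, its kernel is the orthogonal complement of its range. Hence a vector
  common to the kernel and the closed range is orthogonal to itself, and the orthogonal projection
  onto the closed range changes a vector only by an element of the kernel.
\<close>
lemma closure_range_inter_kernel:
  assumes "d \<in> closure (range A)" and "A d = 0"
  shows "d = 0"
proof -
  have "closed {v. cinner v d = 0}"
    by (intro closed_Collect_eq linear_continuous_on bounded_linear_cinner_left continuous_on_const)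
  moreover have "range A \<subseteq> {v. cinner v d = 0}"
    using assms(2) by (auto simp: A_selfadjoint)
  ultimately have "closure (range A) \<subseteq> {v. cinner v d = 0}"
    by (rule closure_minimal[rotated])
  then show ?thesis
    using assms(1) by (auto simp: cinner_self)
qed

lemma projection_onto_closure_range:
  obtains p where "p \<in> closure (range A)" "A (x - p) = 0"
proof -
  have R: "csubspace (closure (range A))"
    by (intro csubspace_closure csubspace_range bounded_clinear_A)
  obtain p where p: "p \<in> closure (range A)"
    "\<And>y. y \<in> closure (range A) \<Longrightarrow> cinner y (x - p) = 0"
    using orthogonal_projection[OF R closed_closure, of x] by blast
  have "A (x - p) = 0"
  proof (rule cinner_ext)
    have "A z \<in> closure (range A)" for z
      by (rule subsetD[OF closure_subset rangeI])
    from p(2)[OF this] show "cinner z (A (x - p)) = cinner z 0" for z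
      by (simp add: A_selfadjoint)
  qed
  with p(1) show ?thesis
    by (rule that)
qed

text \<open>
  The range inclusion defining \<open>B_A\<close> gives, for each \<open>x\<close>, exactly one \<open>X x\<close> in the closed range of
  \<open>A\<close> with \<open>A (X x) = T\<^sup>* (A x)\<close>; uniqueness makes \<open>X\<close> linear. Boundedness of \<open>X\<close> is the analytic
  point: \<open>cinner (X x) (A w) = cinner x (A (T w))\<close> is continuous in \<open>x\<close> for each fixed \<open>w\<close>, so
  uniform boundedness applies to these functionals after division by \<open>\<parallel>A w\<parallel>\<close>.
\<close>
lemma sharp_exists:
  assumes T: "T \<in> B_A A"
  shows "\<exists>!X. bounded_clinear X \<and> A \<circ> X = cadjoint T \<circ> A \<and> range X \<subseteq> closure (range A)"
proof -
  let ?R = "closure (range A)"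
  have T_bd: "bounded_clinear T" and T_range: "range (cadjoint T \<circ> A) \<subseteq> range A"
    using T by (simp_all add: B_A_def)
  have R: "csubspace ?R"
    by (intro csubspace_closure csubspace_range bounded_clinear_A)
  have unique: "u = v" if "u \<in> ?R" "v \<in> ?R" "A u = A v" for u v
  proof -
    have "u - v = 0"
    proof (rule closure_range_inter_kernel)
      show "u - v \<in> ?R"
        using R that(1,2) by (rule csubspace_diff)
      show "A (u - v) = 0"
        using that(3) by (simp add: bounded_clinear_diff[OF bounded_clinear_A])
    qed
    then show ?thesis
      by simp
  qed
  have "\<exists>p. p \<in> ?R \<and> A p = cadjoint T (A x)" for x
  proof -
    obtain w where w: "cadjoint T (A x) = A w"
      using T_range by auto
    obtain p where "p \<in> ?R" "A (w - p) = 0"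
      by (rule projection_onto_closure_range)
    then show ?thesis
      by (auto simp: w bounded_clinear_diff[OF bounded_clinear_A])
  qed
  then obtain X where X: "\<And>x. X x \<in> ?R" "\<And>x. A (X x) = cadjoint T (A x)"
    by metis
  have bd_adj: "bounded_clinear (cadjoint T)"
    using T_bd by (rule bounded_clinear_cadjoint)
  have X_add: "X (x + y) = X x + X y" for x y
    by (rule unique) (simp_all add: X R csubspace_add bounded_clinear_add[OF bounded_clinear_A]
        bounded_clinear_add[OF bd_adj])
  have X_scaleC: "X (c *\<^sub>C x) = c *\<^sub>C X x" for c x
    by (rule unique) (simp_all add: X R csubspace_scaleC
        bounded_clinear_scaleC[OF bounded_clinear_A] bounded_clinear_scaleC[OF bd_adj])
  have X_A: "cinner (X x) (A w) = cinner x (A (T w))" for x w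
  proof -
    have "cinner (A (X x)) w = cnj (cinner (T w) (A x))"
      unfolding X(2) cinner_cadjoint[OF T_bd] by (rule cinner_commute)
    then show ?thesis
      by (metis A_selfadjoint cinner_commute)
  qed
  \<comment> \<open>For \<open>A w = 0\<close> the inverse is \<open>0\<close>, so \<open>f w\<close> is then the zero functional.\<close>
  define f where "f w x = inverse (norm (A w)) *\<^sub>R cinner x (A (T w))" for w x
  have f_linear: "bounded_linear (f w)" for w
    unfolding f_def
    by (rule bounded_linear_compose[OF bounded_linear_scaleR_right bounded_linear_cinner_left])
  have f_pointwise: "\<exists>C. \<forall>w. norm (f w x) \<le> C" for x
  proof -
    have "norm (f w x) \<le> norm (X x)" for w
    proof (cases "A w = 0")
      case False
      have "cmod (cinner (X x) (A w)) \<le> norm (X x) * norm (A w)"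
        by (rule cinner_Cauchy_Schwarz)
      then show ?thesis
        using False by (simp add: f_def X_A field_simps)
    qed (simp add: f_def)
    then show ?thesis
      by blast
  qed
  obtain K where K: "\<And>w x. norm (f w x) \<le> K * norm x"
    using uniform_boundedness[of f, OF f_linear f_pointwise] by blast
  have "norm (X x) \<le> K * norm x" for x
  proof -
    have "cmod (cinner v (X x)) \<le> K * norm x * norm v" if "v \<in> ?R" for v
    proof -
      have "closed {v. cmod (cinner v (X x)) \<le> K * norm x * norm v}"
        by (intro closed_Collect_le continuous_intros linear_continuous_on
            bounded_linear_cinner_left)
      moreover have "range A \<subseteq> {v. cmod (cinner v (X x)) \<le> K * norm x * norm v}"
      proof clarify
        fix w
        have "cmod (cinner (A w) (X x)) = cmod (cinner x (A (T w)))"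
          by (metis X_A cinner_commute complex_mod_cnj)
        also have "\<dots> \<le> K * norm x * norm (A w)"
        proof (cases "A w = 0")
          case True
          then show ?thesis
            by (simp flip: X_A)
        next
          case False
          then show ?thesis
            using K[of w x] by (simp add: f_def field_simps)
        qed
        finally show "cmod (cinner (A w) (X x)) \<le> K * norm x * norm (A w)" .
      qed
      ultimately have "?R \<subseteq> {v. cmod (cinner v (X x)) \<le> K * norm x * norm v}"
        by (rule closure_minimal[rotated])
      then show ?thesis
        using that by blast
    qed
    from this[OF X(1)[of x]] have "norm (X x) * norm (X x) \<le> K * norm x * norm (X x)"
      by (simp add: cinner_self norm_power power2_eq_square norm_mult)
    moreover have "0 \<le> K * norm x"
      using K[of 0 x] norm_ge_zero order_trans by blast
    ultimately show ?thesis
      by (cases "X x = 0") simp_all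
  qed
  with X_add X_scaleC have bd_X: "bounded_clinear X"
    by (rule bounded_clinearI)
  show ?thesis
  proof (rule ex1I[of _ X])
    show "bounded_clinear X \<and> A \<circ> X = cadjoint T \<circ> A \<and> range X \<subseteq> ?R"
      using bd_X X by (simp add: fun_eq_iff image_subset_iff)
    show "Y = X" if Y: "bounded_clinear Y \<and> A \<circ> Y = cadjoint T \<circ> A \<and> range Y \<subseteq> ?R" for Y
    proof
      fix x
      have "A (Y x) = cadjoint T (A x)"
        using fun_cong[OF Y[THEN conjunct2, THEN conjunct1], of x] by simp
      then have "A (Y x) = A (X x)"
        by (simp add: X(2))
      moreover have "Y x \<in> ?R"
        using Y rangeI[of Y x] by (elim conjE subsetD)
      ultimately show "Y x = X x"
        using X(1) unique by blast
    qed
  qed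
qed

lemma A_adjoint_sharp:
  assumes "T \<in> B_A A"
  shows "A_adjoint T (sharp_A A T)"
proof -
  have T: "bounded_clinear T"
    using assms by (simp add: B_A_def)
  have sharp: "bounded_clinear (sharp_A A T) \<and> A \<circ> sharp_A A T = cadjoint T \<circ> A \<and>
      range (sharp_A A T) \<subseteq> closure (range A)"
    unfolding sharp_A_def by (rule theI'[OF sharp_exists[OF assms]])
  have "\<forall>x y. ip (T x) y = ip x (sharp_A A T y)"
    using A_adjoint_iff_commutes[OF T] sharp[THEN conjunct2, THEN conjunct1] by (rule iffD2)
  then show ?thesis
    unfolding A_adjoint_def using T sharp[THEN conjunct1] by (intro conjI)
qed

text \<open>
  Together with \<open>A_adjoint_sharp\<close> this identifies \<open>B_A A\<close> with the operators that have a bounded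
  adjoint for the form, so its closure under algebraic operations is that of \<open>A_adjoint\<close>.
\<close>
lemma B_A_I:
  assumes "A_adjoint T X"
  shows "T \<in> B_A A"
proof -
  have T: "bounded_clinear T"
    using assms by (rule A_adjoint_bounded_left)
  moreover have "\<forall>x y. ip (T x) y = ip x (X y)"
    using A_adjoint_ip[OF assms] by blast
  ultimately have eq: "A \<circ> X = cadjoint T \<circ> A"
    by (rule A_adjoint_iff_commutes[THEN iffD1])
  have "range (cadjoint T \<circ> A) \<subseteq> range A"
    unfolding eq[symmetric] by (simp add: image_subset_iff)
  with T show ?thesis
    by (simp add: B_A_def)
qed

text \<open>
  Inside the form \<open>sharp_A A T\<close> may be exchanged for any adjoint: for the evident one when \<open>T\<close> is a
  sum or a scalar multiple, and for \<open>R\<close> when \<open>T = sharp_A A R\<close>.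
\<close>
lemma ip_sharp:
  assumes "A_adjoint T X"
  shows "ip (sharp_A A T x) y = ip (X x) y"
proof -
  have "ip (sharp_A A T x) y = ip x (T y)"
    by (rule A_adjoint_ip[OF A_adjoint_sym[OF A_adjoint_sharp[OF B_A_I[OF assms]]]])
  also have "\<dots> = ip (X x) y"
    by (rule A_adjoint_ip[OF A_adjoint_sym[OF assms], symmetric])
  finally show ?thesis .
qed

section \<open>Boundedness for the seminorm and the operator seminorm\<close>

text \<open>
  The operator \<open>S = X T\<close> is symmetric for the form, and Cauchy-Schwarz gives
  \<open>(nrm (S\<^sup>n x))\<^sup>2 \<le> nrm (S\<^sup>2\<^sup>n x) * nrm x\<close>. Repeated squaring for a unit vector \<open>x\<close> bounds
  \<open>nrm (S x) ^ m\<close> by \<open>nrm (S\<^sup>m x)\<close> for every power \<open>m\<close> of two. The latter is at most a constant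
  times \<open>k ^ m\<close>, where \<open>k\<close> bounds \<open>S\<close> in the norm of the space, and this forces \<open>nrm (S x) \<le> k\<close>.
  Finally \<open>(nrm (T x))\<^sup>2 = ip (S x) x\<close>, whence the bound \<open>sqrt k\<close> for \<open>T\<close>.
\<close>
lemma A_adjoint_nrm_bounded:
  assumes TX: "A_adjoint T X"
  obtains c where "c \<ge> 0" "\<And>x. nrm (T x) \<le> c * nrm x"
proof -
  define S where "S x = X (T x)" for x
  have S_bd: "bounded_clinear S"
    unfolding S_def[abs_def]
    by (rule bounded_clinear_compose[OF A_adjoint_bounded_right[OF TX] A_adjoint_bounded_left[OF TX]])
  have T_S: "(nrm (T x))\<^sup>2 \<le> nrm (S x) * nrm x" for x
  proof -
    have "(nrm (T x))\<^sup>2 = cmod (ip (T x) (T x))"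
      by (simp add: ip_self norm_power)
    also have "ip (T x) (T x) = ip (S x) x"
      unfolding S_def by (rule A_adjoint_ip[OF A_adjoint_sym[OF TX], symmetric])
    also have "cmod \<dots> \<le> nrm (S x) * nrm x"
      by (rule ip_Cauchy_Schwarz)
    finally show ?thesis .
  qed
  have S_sym: "ip (S x) y = ip x (S y)" for x y
    using A_adjoint_ip[OF TX] A_adjoint_ip[OF A_adjoint_sym[OF TX]] by (simp add: S_def)
  then have S_pow_sym: "ip ((S ^^ n) x) y = ip x ((S ^^ n) y)" for n x y
    by (induction n arbitrary: x y) (simp_all add: funpow_swap1)
  have square: "(nrm ((S ^^ n) x))\<^sup>2 \<le> nrm ((S ^^ (2 * n)) x) * nrm x" for n x
  proof -
    have "(nrm ((S ^^ n) x))\<^sup>2 = cmod (ip ((S ^^ n) x) ((S ^^ n) x))"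
      by (simp add: ip_self norm_power)
    also have "\<dots> = cmod (ip x ((S ^^ (2 * n)) x))"
      by (simp add: S_pow_sym mult_2 funpow_add)
    also have "\<dots> \<le> nrm x * nrm ((S ^^ (2 * n)) x)"
      by (rule ip_Cauchy_Schwarz)
    finally show ?thesis
      by (simp add: mult.commute)
  qed
  have iterate: "nrm (S x) ^ 2 ^ n \<le> nrm ((S ^^ (2 ^ n)) x)" if "nrm x = 1" for n x
  proof (induction n)
    case (Suc n)
    have "nrm (S x) ^ 2 ^ Suc n = (nrm (S x) ^ 2 ^ n)\<^sup>2"
      by (simp add: power_mult[symmetric] mult.commute)
    also have "\<dots> \<le> (nrm ((S ^^ (2 ^ n)) x))\<^sup>2"
      using Suc.IH by (rule power_mono) simp
    also have "\<dots> \<le> nrm ((S ^^ (2 ^ Suc n)) x)"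
      using square[of "2 ^ n" x] that by simp
    finally show ?case .
  qed simp
  obtain C where C: "C > 0" "\<And>x. nrm x \<le> C * norm x"
    using nrm_le_norm by blast
  obtain k where k: "k > 0" "\<And>x. norm (S x) \<le> k * norm x"
    using bounded_clinear_bound[OF S_bd] by blast
  have power_bound: "norm ((S ^^ n) x) \<le> k ^ n * norm x" for n x
  proof (induction n)
    case (Suc n)
    have "norm ((S ^^ Suc n) x) \<le> k * norm ((S ^^ n) x)"
      using k(2) by simp
    also have "\<dots> \<le> k * (k ^ n * norm x)"
      using Suc.IH k(1) by simp
    finally show ?case
      by (simp add: mult.assoc)
  qed simp
  \<comment> \<open>If \<open>nrm (S x) / k > 1\<close>, its powers would outgrow the constant \<open>C * norm x\<close>.\<close>
  have S_unit: "nrm (S x) \<le> k" if x: "nrm x = 1" for x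
  proof (rule ccontr)
    assume "\<not> nrm (S x) \<le> k"
    then have "nrm (S x) / k > 1"
      using k(1) by simp
    then obtain n where n: "C * norm x < (nrm (S x) / k) ^ n"
      using real_arch_pow by blast
    have "n \<le> 2 ^ n"
      using less_exp[of n] by simp
    then have "(nrm (S x) / k) ^ n \<le> (nrm (S x) / k) ^ 2 ^ n"
      using \<open>nrm (S x) / k > 1\<close> by (intro power_increasing) simp_all
    also have "\<dots> \<le> C * norm x"
    proof -
      have "nrm (S x) ^ 2 ^ n \<le> C * (k ^ 2 ^ n * norm x)"
        using iterate[OF x, of n] C(2)[of "(S ^^ (2 ^ n)) x"]
          mult_left_mono[OF power_bound[of "2 ^ n" x] less_imp_le[OF C(1)]] by linarith
      then show ?thesis
        using k(1) by (simp add: power_divide divide_le_eq mult_ac)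
    qed
    finally show False
      using n by simp
  qed
  have "nrm (T x) \<le> sqrt k * nrm x" for x
  proof (cases "nrm x = 0")
    case True
    then show ?thesis
      using T_S[of x] by simp
  next
    case False
    define u where "u = complex_of_real (1 / nrm x) *\<^sub>C x"
    have "nrm u = 1"
      using False by (simp add: u_def nrm_scaleC norm_divide)
    have "nrm (S u) = nrm (S x) / nrm x"
      by (simp add: u_def bounded_clinear_scaleC[OF S_bd] nrm_scaleC norm_divide)
    then have "nrm (S x) \<le> k * nrm x"
      using S_unit[OF \<open>nrm u = 1\<close>] False by (simp add: divide_le_eq less_le)
    then have "nrm (S x) * nrm x \<le> k * nrm x * nrm x"
      by (rule mult_right_mono) simp
    then have "(nrm (T x))\<^sup>2 \<le> (sqrt k * nrm x)\<^sup>2"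
      using T_S[of x] k(1) by (simp add: power_mult_distrib) (simp add: power2_eq_square mult_ac)
    then show ?thesis
      by (rule power2_le_imp_le) (use k(1) in simp)
  qed
  then show ?thesis
    using that[of "sqrt k"] k(1) by simp
qed

end

section \<open>The operator seminorm as a supremum of form values\<close>

text \<open>
  A nonzero \<open>A\<close> guarantees vectors with \<open>nrm x = 1\<close>, so that none of the suprema below is taken
  over an empty set.
\<close>
locale nonzero_positive_operator = positive_operator +
  assumes nonzero: "A \<noteq> (\<lambda>x. 0)"
begin

lemma nrm_pos:
  assumes "x \<in> closure (range A)" "x \<noteq> 0"
  shows "0 < nrm x"
proof -
  have "nrm x \<noteq> 0"
    using assms closure_range_inter_kernel nrm_eq_0_iff by blast
  then show ?thesis
    by (simp add: less_le)
qed

lemma closure_range_nonzero: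
  obtains x where "x \<in> closure (range A)" "x \<noteq> 0"
proof -
  obtain w where "A w \<noteq> 0"
    using nonzero by (auto simp: fun_eq_iff)
  then show ?thesis
    by (rule that[OF subsetD[OF closure_subset rangeI]])
qed

lemma nrm_normalized:
  assumes "nrm x \<noteq> 0"
  shows "nrm (complex_of_real (1 / nrm x) *\<^sub>C x) = 1"
  using assms by (simp add: nrm_scaleC norm_divide)

lemma unit_exists:
  obtains x where "nrm x = 1"
proof -
  obtain x where "x \<in> closure (range A)" "x \<noteq> 0"
    by (rule closure_range_nonzero)
  then have "nrm x \<noteq> 0"
    using nrm_pos[of x] by simp
  then show ?thesis
    by (rule that[OF nrm_normalized])
qed

lemma opnorm_le:
  assumes "\<And>x. nrm (T x) \<le> c * nrm x"
  shows "opnorm_A A T \<le> c"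
  unfolding opnorm_A_def
proof (rule cSup_least)
  obtain x where "x \<in> closure (range A)" "x \<noteq> 0"
    by (rule closure_range_nonzero)
  then show "{nrm (T x) / nrm x |x. x \<in> closure (range A) \<and> x \<noteq> 0} \<noteq> {}"
    by blast
next
  fix s
  assume "s \<in> {nrm (T x) / nrm x |x. x \<in> closure (range A) \<and> x \<noteq> 0}"
  then obtain x where "s = nrm (T x) / nrm x" "0 < nrm x"
    using nrm_pos by blast
  then show "s \<le> c"
    using assms[of x] by (simp add: divide_le_eq)
qed

text \<open>
  The supremum defining \<open>opnorm_A\<close> runs over the closed range of \<open>A\<close> only, but it controls every
  vector: the component orthogonal to the range lies in the kernel of \<open>A\<close>, where \<open>nrm\<close> vanishes,
  and an operator with an adjoint for the form maps null vectors to null vectors.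
\<close>
lemma nrm_le_opnorm:
  assumes TX: "A_adjoint T X"
  shows "nrm (T x) \<le> opnorm_A A T * nrm x"
proof -
  obtain c where c: "c \<ge> 0" "\<And>x. nrm (T x) \<le> c * nrm x"
    using A_adjoint_nrm_bounded[OF TX] by blast
  have on_range: "nrm (T p) \<le> opnorm_A A T * nrm p" if "p \<in> closure (range A)" for p
  proof (cases "p = 0")
    case True
    then show ?thesis
      using c(2)[of 0] by simp
  next
    case False
    have "bdd_above {nrm (T x) / nrm x |x. x \<in> closure (range A) \<and> x \<noteq> 0}"
    proof (rule bdd_aboveI[of _ c])
      fix s
      assume "s \<in> {nrm (T x) / nrm x |x. x \<in> closure (range A) \<and> x \<noteq> 0}"
      then obtain x where "s = nrm (T x) / nrm x" "0 < nrm x"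
        using nrm_pos by blast
      then show "s \<le> c"
        using c(2)[of x] by (simp add: divide_le_eq)
    qed
    then have "nrm (T p) / nrm p \<le> opnorm_A A T"
      unfolding opnorm_A_def using that False by (intro cSup_upper) blast+
    then show ?thesis
      using nrm_pos[OF that False] by (simp add: divide_le_eq)
  qed
  have shift: "nrm (u + n) = nrm u" if "nrm n = 0" for u n
  proof -
    have "ip (u + n) (u + n) = ip u u"
      using ip_eq_0[OF that] ip_commute[of u n] by (simp add: ip_add_left ip_add_right)
    then show ?thesis
      by (simp add: vnorm_A_def)
  qed
  obtain p where p: "p \<in> closure (range A)" "A (x - p) = 0"
    using projection_onto_closure_range[of x] by blast
  have null: "nrm (x - p) = 0"
    using p(2) by (simp add: nrm_eq_0_iff)
  have null': "nrm (T (x - p)) = 0"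
    using c(2)[of "x - p"] null by (simp add: antisym)
  have "T p + T (x - p) = T x"
    using bounded_clinear_add[OF A_adjoint_bounded_left[OF TX], of p "x - p"] by simp
  then have "nrm (T x) = nrm (T p)"
    using shift[OF null', of "T p"] by simp
  moreover have "nrm x = nrm p"
    using shift[OF null, of p] by simp
  ultimately show ?thesis
    using on_range[OF p(1)] by simp
qed

lemma opnorm_nonneg:
  assumes "A_adjoint T X"
  shows "0 \<le> opnorm_A A T"
proof -
  obtain x where "nrm x = 1"
    by (rule unit_exists)
  then show ?thesis
    using nrm_le_opnorm[OF assms, of x] order_trans[OF nrm_nonneg[of "T x"]] by simp
qed

lemma form_le_opnorm:
  assumes "A_adjoint T X" "nrm x = 1" "nrm y = 1"
  shows "cmod (ip (T x) y) \<le> opnorm_A A T"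
  using ip_Cauchy_Schwarz[of "T x" y] nrm_le_opnorm[OF assms(1), of x] assms(2,3) by simp

text \<open>
  The pair of \<open>x\<close> and \<open>T x\<close>, both normalised, has the form value \<open>nrm (T x) / nrm x\<close>. With
  \<open>form_le_opnorm\<close> the operator seminorm is thus the supremum of the form values at unit vectors.
\<close>
lemma opnorm_le_form:
  assumes TX: "A_adjoint T X" and "0 \<le> c"
    and form: "\<And>x y. nrm x = 1 \<Longrightarrow> nrm y = 1 \<Longrightarrow> cmod (ip (T x) y) \<le> c"
  shows "opnorm_A A T \<le> c"
proof (rule opnorm_le)
  fix x
  show "nrm (T x) \<le> c * nrm x"
  proof (cases "nrm x = 0 \<or> nrm (T x) = 0")
    case True
    then have "nrm (T x) = 0"
      using nrm_le_opnorm[OF TX, of x] by (auto intro: antisym)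
    then show ?thesis
      using \<open>0 \<le> c\<close> by simp
  next
    case False
    define u where "u = complex_of_real (1 / nrm x) *\<^sub>C x"
    define v where "v = complex_of_real (1 / nrm (T x)) *\<^sub>C T x"
    have "cmod (ip (T u) v) \<le> c"
      using False unfolding u_def v_def by (intro form nrm_normalized) simp_all
    moreover have "cmod (ip (T u) v) = nrm (T x) / nrm x"
      using False
      by (simp add: u_def v_def bounded_clinear_scaleC[OF A_adjoint_bounded_left[OF TX]]
          ip_scaleC_left ip_scaleC_right ip_self norm_mult norm_divide norm_power power2_eq_square)
    ultimately show ?thesis
      using False by (simp add: divide_le_eq less_le)
  qed
qed

lemma opnorm_adjoint:
  assumes "A_adjoint T X"
  shows "opnorm_A A X = opnorm_A A T"
proof -
  have "opnorm_A A X \<le> opnorm_A A T" if TX: "A_adjoint T X" for T X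
  proof (rule opnorm_le_form[OF A_adjoint_sym[OF TX] opnorm_nonneg[OF TX]])
    fix x y
    assume "nrm x = 1" "nrm y = 1"
    then show "cmod (ip (X x) y) \<le> opnorm_A A T"
      using form_le_opnorm[OF TX, of y x] A_adjoint_ip[OF TX, of y x] ip_commute[of "X x" y] by simp
  qed
  from this[OF assms] this[OF A_adjoint_sym[OF assms]] show ?thesis
    by (rule antisym)
qed

section \<open>The double supremum formula\<close>

definition pair_form :: "('a \<Rightarrow> 'a) \<Rightarrow> 'a \<Rightarrow> 'a \<Rightarrow> real"
  where "pair_form T x y = sqrt ((cmod (ip (T x) y))\<^sup>2 + (cmod (ip (sharp_A A T x) y))\<^sup>2)"

lemma pair_form_eq:
  assumes "A_adjoint T X"
  shows "pair_form T x y = sqrt ((cmod (ip (T x) y))\<^sup>2 + (cmod (ip (X x) y))\<^sup>2)"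
  by (simp add: pair_form_def ip_sharp[OF assms])

lemma pair_form_nonneg: "0 \<le> pair_form T x y"
  by (simp add: pair_form_def)

lemma two_term_Cauchy_Schwarz:
  "(p * r + q * s)\<^sup>2 \<le> (p\<^sup>2 + q\<^sup>2) * (r\<^sup>2 + s\<^sup>2)" for p q r s :: real
proof -
  have "(p\<^sup>2 + q\<^sup>2) * (r\<^sup>2 + s\<^sup>2) = (p * r + q * s)\<^sup>2 + (p * s - q * r)\<^sup>2"
    by (simp add: power2_eq_square algebra_simps)
  then show ?thesis
    by simp
qed

text \<open>
  Exchanging two suprema: for fixed unit vectors the supremum of \<open>\<bar>\<alpha> a + \<beta> b\<bar>\<close> over the unit ball of
  pairs \<open>(\<alpha>, \<beta>)\<close> is the Euclidean length of \<open>(a, b)\<close>, attained at the normalised conjugate pair.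
\<close>
lemma Omega_set_le_iff_pair_form:
  assumes T: "T \<in> B_A A" and "0 \<le> c"
  shows "(\<forall>s\<in>Omega_A_set A T. s \<le> c) \<longleftrightarrow>
    (\<forall>x y. nrm x = 1 \<longrightarrow> nrm y = 1 \<longrightarrow> pair_form T x y \<le> c)"
proof -
  let ?X = "sharp_A A T"
  let ?U = "\<lambda>\<alpha> \<beta> x. \<alpha> *\<^sub>C T x + \<beta> *\<^sub>C ?X x"
  have TX: "A_adjoint T ?X"
    using T by (rule A_adjoint_sharp)
  have U: "A_adjoint (?U \<alpha> \<beta>) (\<lambda>x. cnj \<alpha> *\<^sub>C ?X x + cnj \<beta> *\<^sub>C T x)" for \<alpha> \<beta>
    by (rule A_adjoint_plus[OF A_adjoint_scaled[OF TX] A_adjoint_scaled[OF A_adjoint_sym[OF TX]]])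
  have ip_U: "ip (?U \<alpha> \<beta> x) y = \<alpha> * ip (T x) y + \<beta> * ip (?X x) y" for \<alpha> \<beta> x y
    by (simp add: ip_add_left ip_scaleC_left)
  show ?thesis
  proof (intro iffI allI impI ballI)
    fix x y
    assume le: "\<forall>s\<in>Omega_A_set A T. s \<le> c" and unit: "nrm x = 1" "nrm y = 1"
    define a b s where "a = ip (T x) y" and "b = ip (?X x) y" and "s = pair_form T x y"
    have s: "s\<^sup>2 = (cmod a)\<^sup>2 + (cmod b)\<^sup>2"
      by (simp add: s_def a_def b_def pair_form_def)
    show "pair_form T x y \<le> c"
    proof (cases "s = 0")
      case True
      then show ?thesis
        using \<open>0 \<le> c\<close> by (simp add: s_def)
    next
      case False
      define \<alpha> \<beta> where "\<alpha> = cnj a / complex_of_real s" and "\<beta> = cnj b / complex_of_real s"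
      have "(cmod \<alpha>)\<^sup>2 + (cmod \<beta>)\<^sup>2 = ((cmod a)\<^sup>2 + (cmod b)\<^sup>2) / s\<^sup>2"
        by (simp add: \<alpha>_def \<beta>_def norm_divide power_divide add_divide_distrib)
      also have "\<dots> = 1"
        using False by (simp flip: s)
      finally have "opnorm_A A (?U \<alpha> \<beta>) \<in> Omega_A_set A T"
        unfolding Omega_A_set_def by (intro CollectI exI[of _ \<alpha>] exI[of _ \<beta>]) simp
      then have "opnorm_A A (?U \<alpha> \<beta>) \<le> c"
        using le by blast
      moreover have "ip (?U \<alpha> \<beta> x) y = complex_of_real s"
      proof -
        have "ip (?U \<alpha> \<beta> x) y = (a * cnj a + b * cnj b) / complex_of_real s"
          unfolding ip_U a_def[symmetric] b_def[symmetric]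
          by (simp add: \<alpha>_def \<beta>_def add_divide_distrib mult.commute)
        also have "a * cnj a + b * cnj b = complex_of_real (s\<^sup>2)"
          unfolding s by (simp only: complex_norm_square of_real_add)
        finally show ?thesis
          using False by (simp add: power2_eq_square)
      qed
      ultimately show ?thesis
        using form_le_opnorm[OF U[of \<alpha> \<beta>] unit] pair_form_nonneg[of T x y] by (simp add: s_def)
    qed
  next
    fix t
    assume le: "\<forall>x y. nrm x = 1 \<longrightarrow> nrm y = 1 \<longrightarrow> pair_form T x y \<le> c"
      and "t \<in> Omega_A_set A T"
    then obtain \<alpha> \<beta> where t: "t = opnorm_A A (?U \<alpha> \<beta>)" and \<alpha>\<beta>: "(cmod \<alpha>)\<^sup>2 + (cmod \<beta>)\<^sup>2 \<le> 1"
      unfolding Omega_A_set_def by blast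
    show "t \<le> c"
      unfolding t
    proof (rule opnorm_le_form[OF U \<open>0 \<le> c\<close>])
      fix x y
      assume unit: "nrm x = 1" "nrm y = 1"
      let ?a = "ip (T x) y" and ?b = "ip (?X x) y"
      have "cmod (ip (?U \<alpha> \<beta> x) y) \<le> cmod \<alpha> * cmod ?a + cmod \<beta> * cmod ?b"
        unfolding ip_U by (metis norm_mult norm_triangle_ineq)
      also have "\<dots> \<le> pair_form T x y"
        unfolding pair_form_def
      proof (rule real_le_rsqrt)
        have "(cmod \<alpha> * cmod ?a + cmod \<beta> * cmod ?b)\<^sup>2
            \<le> ((cmod \<alpha>)\<^sup>2 + (cmod \<beta>)\<^sup>2) * ((cmod ?a)\<^sup>2 + (cmod ?b)\<^sup>2)"
          by (rule two_term_Cauchy_Schwarz)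
        also have "\<dots> \<le> 1 * ((cmod ?a)\<^sup>2 + (cmod ?b)\<^sup>2)"
          using \<alpha>\<beta> by (rule mult_right_mono) simp
        finally show "(cmod \<alpha> * cmod ?a + cmod \<beta> * cmod ?b)\<^sup>2 \<le> (cmod ?a)\<^sup>2 + (cmod ?b)\<^sup>2"
          by simp
      qed
      also have "\<dots> \<le> c"
        using le unit by blast
      finally show "cmod (ip (?U \<alpha> \<beta> x) y) \<le> c" .
    qed
  qed
qed

lemma pair_form_bounded:
  assumes "T \<in> B_A A" "nrm x = 1" "nrm y = 1"
  shows "pair_form T x y \<le> sqrt ((opnorm_A A T)\<^sup>2 + (opnorm_A A T)\<^sup>2)"
proof -
  note TX = A_adjoint_sharp[OF assms(1)]
  show ?thesis
    unfolding pair_form_def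
    using form_le_opnorm[OF TX assms(2,3)]
      form_le_opnorm[OF A_adjoint_sym[OF TX] assms(2,3), unfolded opnorm_adjoint[OF TX]]
    by (intro real_sqrt_le_mono add_mono power_mono) simp_all
qed

lemma Omega_A_set_bdd:
  assumes "T \<in> B_A A"
  shows "bdd_above (Omega_A_set A T)"
proof -
  have "\<forall>s\<in>Omega_A_set A T. s \<le> sqrt ((opnorm_A A T)\<^sup>2 + (opnorm_A A T)\<^sup>2)"
    using Omega_set_le_iff_pair_form[OF assms] pair_form_bounded[OF assms] by simp
  then show ?thesis
    unfolding bdd_above_def by blast
qed

lemma opnorm_le_Omega:
  assumes "T \<in> B_A A"
  shows "opnorm_A A T \<le> Omega_A A T"
proof -
  have "opnorm_A A (\<lambda>x. 1 *\<^sub>C T x + 0 *\<^sub>C sharp_A A T x) \<in> Omega_A_set A T"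
    unfolding Omega_A_set_def by (intro CollectI exI[of _ 1] exI[of _ 0]) simp
  then show ?thesis
    unfolding Omega_A_def using Omega_A_set_bdd[OF assms] by (intro cSup_upper) simp_all
qed

lemma Omega_nonneg:
  assumes "T \<in> B_A A"
  shows "0 \<le> Omega_A A T"
  using opnorm_nonneg[OF A_adjoint_sharp[OF assms]] opnorm_le_Omega[OF assms] by linarith

lemma pair_form_le_Omega:
  assumes "T \<in> B_A A" "nrm x = 1" "nrm y = 1"
  shows "pair_form T x y \<le> Omega_A A T"
proof -
  have "\<forall>s\<in>Omega_A_set A T. s \<le> Omega_A A T"
    unfolding Omega_A_def using Omega_A_set_bdd[OF assms(1)] by (simp add: cSup_upper)
  then show ?thesis
    using Omega_set_le_iff_pair_form[OF assms(1) Omega_nonneg[OF assms(1)]] assms(2,3) by blast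
qed

lemma Omega_le:
  assumes "T \<in> B_A A" and le: "\<And>x y. nrm x = 1 \<Longrightarrow> nrm y = 1 \<Longrightarrow> pair_form T x y \<le> c"
  shows "Omega_A A T \<le> c"
proof -
  obtain x where "nrm x = 1"
    by (rule unit_exists)
  then have "0 \<le> c"
    using le[of x x] pair_form_nonneg[of T x x] by linarith
  have "Omega_A_set A T \<noteq> {}"
    unfolding Omega_A_set_def by (auto intro!: exI[of _ 0])
  then show ?thesis
    unfolding Omega_A_def
    using Omega_set_le_iff_pair_form[OF assms(1) \<open>0 \<le> c\<close>] le by (intro cSup_least) blast+
qed

lemma Omega_eq_Sup_pair_form:
  assumes "T \<in> B_A A"
  shows "Omega_A A T = Sup {pair_form T x y | x y. nrm x = 1 \<and> nrm y = 1}"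
proof (rule antisym)
  let ?S = "{pair_form T x y | x y. nrm x = 1 \<and> nrm y = 1}"
  have "bdd_above ?S"
    using pair_form_bounded[OF assms] by (intro bdd_aboveI) blast
  then show "Omega_A A T \<le> Sup ?S"
    by (intro Omega_le[OF assms] cSup_upper) blast+
  obtain x where "nrm x = 1"
    by (rule unit_exists)
  then show "Sup ?S \<le> Omega_A A T"
    using pair_form_le_Omega[OF assms] by (intro cSup_least) blast+
qed

section \<open>Seminorm properties and estimates\<close>

lemma Omega_scaled:
  assumes T: "T \<in> B_A A"
  shows "Omega_A A (\<lambda>x. c *\<^sub>C T x) = cmod c * Omega_A A T"
proof -
  note TX = A_adjoint_sharp[OF T]
  have cT: "(\<lambda>x. c *\<^sub>C T x) \<in> B_A A"
    by (rule B_A_I[OF A_adjoint_scaled[OF TX]])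
  have form: "pair_form (\<lambda>x. c *\<^sub>C T x) x y = cmod c * pair_form T x y" for x y
    by (simp add: pair_form_eq[OF A_adjoint_scaled[OF TX]] pair_form_eq[OF TX] ip_scaleC_left
        norm_mult power_mult_distrib real_sqrt_mult flip: distrib_left)
  have "Omega_A A (\<lambda>x. c *\<^sub>C T x) \<le> cmod c * Omega_A A T"
    by (rule Omega_le[OF cT]) (simp add: form mult_left_mono pair_form_le_Omega[OF T])
  moreover have "cmod c * Omega_A A T \<le> Omega_A A (\<lambda>x. c *\<^sub>C T x)"
  proof (cases "c = 0")
    case True
    then show ?thesis
      using Omega_nonneg[OF cT] by simp
  next
    case False
    have "Omega_A A T \<le> Omega_A A (\<lambda>x. c *\<^sub>C T x) / cmod c"
    proof (rule Omega_le[OF T])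
      fix x y
      assume "nrm x = 1" "nrm y = 1"
      from pair_form_le_Omega[OF cT this]
      show "pair_form T x y \<le> Omega_A A (\<lambda>x. c *\<^sub>C T x) / cmod c"
        using False by (simp add: form le_divide_eq mult.commute)
    qed
    then show ?thesis
      using False by (simp add: le_divide_eq mult.commute)
  qed
  ultimately show ?thesis
    by (rule antisym)
qed

lemma Omega_triangle:
  assumes S: "S \<in> B_A A" and T: "T \<in> B_A A"
  shows "Omega_A A (\<lambda>x. S x + T x) \<le> Omega_A A S + Omega_A A T"
proof -
  note SY = A_adjoint_sharp[OF S] and TX = A_adjoint_sharp[OF T]
  note sum = A_adjoint_plus[OF SY TX]
  show ?thesis
  proof (rule Omega_le[OF B_A_I[OF sum]])
    fix x y
    assume unit: "nrm x = 1" "nrm y = 1"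
    let ?a = "ip (S x) y" and ?b = "ip (sharp_A A S x) y"
      and ?a' = "ip (T x) y" and ?b' = "ip (sharp_A A T x) y"
    have "pair_form (\<lambda>x. S x + T x) x y = sqrt ((cmod (?a + ?a'))\<^sup>2 + (cmod (?b + ?b'))\<^sup>2)"
      by (simp add: pair_form_eq[OF sum] ip_add_left)
    also have "\<dots> \<le> sqrt ((cmod ?a + cmod ?a')\<^sup>2 + (cmod ?b + cmod ?b')\<^sup>2)"
      by (intro real_sqrt_le_mono add_mono power_mono norm_triangle_ineq norm_ge_zero)
    also have "\<dots> \<le> pair_form S x y + pair_form T x y"
      unfolding pair_form_def by (rule real_sqrt_sum_squares_triangle_ineq)
    also have "\<dots> \<le> Omega_A A S + Omega_A A T"
      using unit by (intro add_mono pair_form_le_Omega S T)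
    finally show "pair_form (\<lambda>x. S x + T x) x y \<le> Omega_A A S + Omega_A A T" .
  qed
qed

text \<open>
  \<open>T\<close> is an adjoint of \<open>sharp_A A T\<close>, so passing to the latter only swaps the two terms under the
  root.
\<close>
lemma Omega_sharp:
  assumes "T \<in> B_A A"
  shows "Omega_A A (sharp_A A T) = Omega_A A T"
proof -
  note XT = A_adjoint_sym[OF A_adjoint_sharp[OF assms]]
  have "pair_form (sharp_A A T) x y = pair_form T x y" for x y
    unfolding pair_form_eq[OF XT] by (simp add: pair_form_def add.commute)
  then show ?thesis
    by (simp add: Omega_eq_Sup_pair_form[OF assms] Omega_eq_Sup_pair_form[OF B_A_I[OF XT]])
qed

text \<open>
  Cauchy-Schwarz removes \<open>y\<close>, and \<open>(nrm (T x))\<^sup>2 + (nrm (X x))\<^sup>2\<close> is the diagonal form value of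
  \<open>X T + T X\<close> at \<open>x\<close>, where \<open>X = sharp_A A T\<close>.
\<close>
lemma Omega_le_sqrt_opnorm_sum:
  assumes T: "T \<in> B_A A"
  shows "Omega_A A T \<le> sqrt (opnorm_A A (\<lambda>x. T (sharp_A A T x) + sharp_A A T (T x)))"
proof (rule Omega_le[OF T])
  fix x y
  assume unit: "nrm x = 1" "nrm y = 1"
  let ?X = "sharp_A A T"
  let ?W = "\<lambda>x. T (?X x) + ?X (T x)"
  note TX = A_adjoint_sharp[OF T]
  note XT = A_adjoint_sym[OF TX]
  have W: "A_adjoint ?W ?W"
    by (rule A_adjoint_plus[OF A_adjoint_compose[OF TX XT] A_adjoint_compose[OF XT TX]])
  have form_le: "(cmod (ip v y))\<^sup>2 \<le> (nrm v)\<^sup>2" for v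
    using ip_Cauchy_Schwarz[of v y] unit by (intro power_mono) simp_all
  have "(cmod (ip (T x) y))\<^sup>2 + (cmod (ip (?X x) y))\<^sup>2 \<le> (nrm (T x))\<^sup>2 + (nrm (?X x))\<^sup>2"
    by (intro add_mono form_le)
  also have "\<dots> = Re (ip (?W x) x)"
  proof -
    have "ip (?W x) x = ip (?X x) (?X x) + ip (T x) (T x)"
      by (simp add: ip_add_left A_adjoint_ip[OF TX, of "?X x"] A_adjoint_ip[OF XT, of "T x"])
    then show ?thesis
      by (simp add: ip_self flip: of_real_power)
  qed
  also have "\<dots> \<le> opnorm_A A ?W"
    using complex_Re_le_cmod[of "ip (?W x) x"] form_le_opnorm[OF W unit(1) unit(1)] by linarith
  finally show "pair_form T x y \<le> sqrt (opnorm_A A ?W)"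
    unfolding pair_form_def by (rule real_sqrt_le_mono)
qed

text \<open>
  An inequality of Boas-Bellman type: the left-hand side \<open>s\<close> is the form value of
  \<open>v = \<alpha>\<^sup>* a + \<beta>\<^sup>* b\<close> at \<open>y\<close>, where \<open>\<alpha>\<close> and \<open>\<beta>\<close> are the coefficients of \<open>a\<close> and \<open>b\<close> along \<open>y\<close>, and
  expanding \<open>(nrm v)\<^sup>2\<close> bounds it by \<open>s\<close> times the right-hand side.
\<close>
lemma Boas_Bellman_pair:
  assumes y: "nrm y = 1" and a: "nrm a \<le> m" and b: "nrm b \<le> m"
  shows "(cmod (ip a y))\<^sup>2 + (cmod (ip b y))\<^sup>2 \<le> m\<^sup>2 + cmod (ip a b)"
proof -
  define \<alpha> \<beta> where "\<alpha> = ip a y" and "\<beta> = ip b y"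
  define s where "s = (cmod \<alpha>)\<^sup>2 + (cmod \<beta>)\<^sup>2"
  define v where "v = cnj \<alpha> *\<^sub>C a + cnj \<beta> *\<^sub>C b"
  have "ip v y = \<alpha> * cnj \<alpha> + \<beta> * cnj \<beta>"
    by (simp add: v_def ip_add_left ip_scaleC_left mult.commute flip: \<alpha>_def \<beta>_def)
  also have "\<dots> = complex_of_real s"
    unfolding s_def by (simp only: complex_norm_square of_real_add)
  finally have "s \<le> nrm v"
    using ip_Cauchy_Schwarz[of v y] y by (simp add: s_def abs_of_nonneg del: of_real_add)
  then have "s\<^sup>2 \<le> (nrm v)\<^sup>2"
    by (intro power_mono) (simp_all add: s_def)
  also have "\<dots> = (cmod \<alpha>)\<^sup>2 * (nrm a)\<^sup>2 + (cmod \<beta>)\<^sup>2 * (nrm b)\<^sup>2 + 2 * Re (cnj \<alpha> * \<beta> * ip a b)"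
  proof -
    define z where "z = cnj \<alpha> * \<beta> * ip a b"
    have "ip v v = \<alpha> * cnj \<alpha> * ip a a + \<beta> * cnj \<beta> * ip b b + (z + cnj z)"
      by (simp add: v_def z_def ip_add_left ip_add_right ip_scaleC_left ip_scaleC_right
          ip_commute[of b a] algebra_simps)
    also have "\<dots> = complex_of_real
        ((cmod \<alpha>)\<^sup>2 * (nrm a)\<^sup>2 + (cmod \<beta>)\<^sup>2 * (nrm b)\<^sup>2 + 2 * Re z)"
      by (simp only: complex_norm_square[symmetric] ip_self complex_add_cnj of_real_add
          of_real_mult of_real_power)
    finally show ?thesis
      by (simp only: ip_self of_real_eq_iff z_def)
  qed
  also have "\<dots> \<le> (cmod \<alpha>)\<^sup>2 * m\<^sup>2 + (cmod \<beta>)\<^sup>2 * m\<^sup>2 + s * cmod (ip a b)"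
  proof (intro add_mono mult_left_mono power_mono a b)
    have "2 * Re (cnj \<alpha> * \<beta> * ip a b) \<le> (2 * cmod \<alpha> * cmod \<beta>) * cmod (ip a b)"
      using complex_Re_le_cmod[of "cnj \<alpha> * \<beta> * ip a b"] by (simp add: norm_mult)
    also have "\<dots> \<le> s * cmod (ip a b)"
      unfolding s_def by (intro mult_right_mono sum_squares_bound norm_ge_zero)
    finally show "2 * Re (cnj \<alpha> * \<beta> * ip a b) \<le> s * cmod (ip a b)" .
  qed simp_all
  finally have "s * s \<le> s * (m\<^sup>2 + cmod (ip a b))"
    by (simp add: s_def power2_eq_square algebra_simps)
  moreover have "0 \<le> s"
    by (simp add: s_def)
  ultimately have "s \<le> m\<^sup>2 + cmod (ip a b)"
    by (cases "s = 0") simp_all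
  then show ?thesis
    by (simp add: s_def \<alpha>_def \<beta>_def)
qed

text \<open>
  The preceding inequality is applied to \<open>T x\<close> and \<open>X x\<close> with \<open>X = sharp_A A T\<close>; the mixed term is
  \<open>ip (T x) (X x) = ip (T (T x)) x\<close>, which the numerical radius of \<open>T\<^sup>2\<close> bounds.
\<close>
lemma Omega_le_sqrt_omega:
  assumes T: "T \<in> B_A A"
  shows "Omega_A A T \<le> sqrt ((opnorm_A A T)\<^sup>2 + omega_A A (T \<circ> T))"
proof (rule Omega_le[OF T])
  fix x y
  assume unit: "nrm x = 1" "nrm y = 1"
  let ?X = "sharp_A A T"
  note TX = A_adjoint_sharp[OF T]
  note XT = A_adjoint_sym[OF TX]
  have TT: "A_adjoint (\<lambda>x. T (T x)) (\<lambda>x. ?X (?X x))"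
    by (rule A_adjoint_compose[OF TX TX])
  have "bdd_above {cmod (ip ((T \<circ> T) x) x) | x. nrm x = 1}"
    using form_le_opnorm[OF TT] by (intro bdd_aboveI[of _ "opnorm_A A (\<lambda>x. T (T x))"]) auto
  then have omega: "cmod (ip ((T \<circ> T) x) x) \<le> omega_A A (T \<circ> T)"
    unfolding omega_A_def using unit by (intro cSup_upper) blast+
  have "(cmod (ip (T x) y))\<^sup>2 + (cmod (ip (?X x) y))\<^sup>2
      \<le> (opnorm_A A T)\<^sup>2 + cmod (ip (T x) (?X x))"
    using nrm_le_opnorm[OF TX, of x] nrm_le_opnorm[OF XT, of x] unit
    by (intro Boas_Bellman_pair) (simp_all add: opnorm_adjoint[OF TX])
  also have "\<dots> \<le> (opnorm_A A T)\<^sup>2 + omega_A A (T \<circ> T)"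
    using omega A_adjoint_ip[OF TX, of "T x" x] by simp
  finally show "pair_form T x y \<le> sqrt ((opnorm_A A T)\<^sup>2 + omega_A A (T \<circ> T))"
    unfolding pair_form_def by (rule real_sqrt_le_mono)
qed

lemma gamma_le:
  assumes T: "T \<in> B_A A"
  shows "gamma_A A T \<le> sqrt 2 * opnorm_A A T"
proof -
  let ?X = "sharp_A A T" and ?t = "opnorm_A A T"
  let ?W = "\<lambda>x. T (?X x) + ?X (T x)"
  note TX = A_adjoint_sharp[OF T]
  note XT = A_adjoint_sym[OF TX]
  have t: "0 \<le> ?t"
    by (rule opnorm_nonneg[OF TX])
  have X_le: "nrm (?X x) \<le> ?t * nrm x" for x
    using nrm_le_opnorm[OF XT] by (simp add: opnorm_adjoint[OF TX])
  have T_le: "nrm (T x) \<le> ?t * nrm x" for x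
    by (rule nrm_le_opnorm[OF TX])
  have "opnorm_A A ?W \<le> 2 * ?t\<^sup>2"
  proof (rule opnorm_le_form)
    show "A_adjoint ?W ?W"
      by (rule A_adjoint_plus[OF A_adjoint_compose[OF TX XT] A_adjoint_compose[OF XT TX]])
    fix x y
    assume unit: "nrm x = 1" "nrm y = 1"
    have "cmod (ip (?W x) y) \<le> cmod (ip (T (?X x)) y) + cmod (ip (?X (T x)) y)"
      unfolding ip_add_left by (rule norm_triangle_ineq)
    also have "\<dots> \<le> nrm (T (?X x)) + nrm (?X (T x))"
      using ip_Cauchy_Schwarz[of "T (?X x)" y] ip_Cauchy_Schwarz[of "?X (T x)" y] unit by simp
    also have "\<dots> \<le> ?t * nrm (?X x) + ?t * nrm (T x)"
      by (intro add_mono T_le X_le)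
    also have "\<dots> \<le> ?t * ?t + ?t * ?t"
      using T_le[of x] X_le[of x] unit t by (intro add_mono mult_left_mono) simp_all
    finally show "cmod (ip (?W x) y) \<le> 2 * ?t\<^sup>2"
      by (simp add: power2_eq_square)
  qed simp
  then have "sqrt (opnorm_A A ?W) \<le> sqrt (2 * ?t\<^sup>2)"
    by (rule real_sqrt_le_mono)
  also have "\<dots> = sqrt 2 * ?t"
    using t by (simp add: real_sqrt_mult)
  finally show ?thesis
    unfolding gamma_A_def by (rule min.coboundedI1)
qed

text \<open>
  A selfadjoint \<open>T\<close> is its own adjoint for the form, so both terms under the root agree.
\<close>
lemma Omega_selfadjoint:
  assumes T: "T \<in> B_A A" and self: "selfadjoint_A A T"
  shows "Omega_A A T = sqrt 2 * opnorm_A A T"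
proof (rule antisym)
  have T_bd: "bounded_clinear T"
    by (rule A_adjoint_bounded_left[OF A_adjoint_sharp[OF T]])
  have TT: "A_adjoint T T"
    unfolding A_adjoint_def
    using T_bd A_adjoint_iff_commutes[OF T_bd, THEN iffD2, OF self[unfolded selfadjoint_A_def]]
    by (intro conjI)
  have form: "pair_form T x y = sqrt 2 * cmod (ip (T x) y)" for x y
    by (simp add: pair_form_eq[OF TT] real_sqrt_mult flip: mult_2)
  show "Omega_A A T \<le> sqrt 2 * opnorm_A A T"
    by (rule Omega_le[OF T]) (simp add: form form_le_opnorm[OF TT])
  have "opnorm_A A T \<le> Omega_A A T / sqrt 2"
  proof (rule opnorm_le_form[OF TT])
    show "0 \<le> Omega_A A T / sqrt 2"
      using Omega_nonneg[OF T] by simp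
    fix x y
    assume "nrm x = 1" "nrm y = 1"
    from pair_form_le_Omega[OF T this] show "cmod (ip (T x) y) \<le> Omega_A A T / sqrt 2"
      by (simp add: form le_divide_eq mult.commute)
  qed
  then show "sqrt 2 * opnorm_A A T \<le> Omega_A A T"
    by (simp add: le_divide_eq mult.commute)
qed

end

theorem proposition4p4:
  fixes A :: "'a::complex_hilbert_space \<Rightarrow> 'a"
  assumes "positive_op A" and "A \<noteq> (\<lambda>x. 0)"
  shows "((\<forall>T\<in>B_A A. bdd_above (Omega_A_set A T)) \<and> seminorm_on (B_A A) (Omega_A A)) \<and>
    (\<forall>T\<in>B_A A. Omega_A A T =
      Sup {sqrt ((cmod (inner_A A (T x) y))\<^sup>2 + (cmod (inner_A A (sharp_A A T x) y))\<^sup>2) | x y.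
        vnorm_A A x = 1 \<and> vnorm_A A y = 1}) \<and>
    (\<forall>T\<in>B_A A. Omega_A A T = Omega_A A (sharp_A A T)) \<and>
    (\<forall>T\<in>B_A A. opnorm_A A T \<le> Omega_A A T \<and> Omega_A A T \<le> gamma_A A T \<and>
      gamma_A A T \<le> sqrt 2 * opnorm_A A T) \<and>
    (\<forall>T\<in>B_A A. selfadjoint_A A T \<longrightarrow> Omega_A A T = sqrt 2 * opnorm_A A T)"
proof -
  interpret nonzero_positive_operator A
    by standard (rule assms)+
  have "seminorm_on (B_A A) (Omega_A A)"
    unfolding seminorm_on_def
    by (intro conjI ballI allI Omega_nonneg Omega_scaled Omega_triangle)
  moreover have "Omega_A A T \<le> gamma_A A T" if "T \<in> B_A A" for T
    unfolding gamma_A_def using that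
    by (intro min.boundedI Omega_le_sqrt_opnorm_sum Omega_le_sqrt_omega)
  ultimately show ?thesis
    using Omega_A_set_bdd Omega_eq_Sup_pair_form[unfolded pair_form_def] Omega_sharp
      opnorm_le_Omega gamma_le Omega_selfadjoint
    by (intro conjI ballI impI) simp_all
qed

end
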